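(* Let $n\ge 3$, $d\ge 1$ with $n+d=6$, let $\delta=\sum_{i=1}^n\varepsilon_i\,dx_i\otimes dx_i$ with $\varepsilon_i=\pm1$ on $\mathbb R^n$, let $(F^d,g_F)$ be a semi-Riemannian manifold with constant scalar curvature $\lambda_F=0$, let $\alpha\in\mathbb R^n$ be nonzero, $\xi(x)=\sum_i\alpha_ix_i$, and assume $\|\alpha\|^2=\sum_i\varepsilon_i\alpha_i^2\neq0$. Let $\varphi,f,h:(a,b)\to(0,\infty)$ be smooth with $h'\ne0$. Then the metric $$g=\frac{\delta}{\varphi(\xi(x))^2}+f(\xi(x))^2g_F\quad\text{on }\xi^{-1}((a,b))\times F^d$$ is a steady gradient Yamabe soliton with potential function $h\circ\xi$ if and only if $f,h,\varphi$ satisfy $$f(\xi)=\frac{k_2}{\varphi(\xi)},\qquad h(\xi)=k_1\int\frac{1}{\varphi^2(\xi)}\,d\xi,\qquad 40\int\frac{\varphi\,d\varphi}{k_1-20k_3\varphi^4}=\xi+k_4,$$ where $k_1\neq0$, $k_2\neq0$, $k_3$ and $k_4$ are constants.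
   Context: A semi-Riemannian manifold $(M,g)$ is a gradient Yamabe soliton with potential function $u\in C^\infty(M)$ and soliton constant $\rho\in\mathbb R$ if $(S_g-\rho)g=\mathrm{Hess}_g(u)$, where $S_g$ is the scalar curvature of $g$; it is steady if $\rho=0$. Primes denote derivatives with respect to $\xi\in(a,b)$. The function $h\circ\xi$ is regarded as a function on $\xi^{-1}((a,b))\times F$ via the projection to the first factor. Integrals are indefinite (antiderivatives); the last identity describes $\varphi$ implicitly as a function of $\xi$.
   Formalization: For constant φ (e.g. φ=f=1, h=ξ on (0,1), F flat) the metric is a steady soliton but the third identity cannot hold; the alternative k1−20k3φ⁴=0 on (a,b), which forces φ constant, is added to it, and otherwise the denominator is required to be nonzero. *)

theory Defs
  imports "HOL-Analysis.Analysis"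
begin

section \<open>Smooth maps between Euclidean spaces\<close>

fun Ck_on :: "nat \<Rightarrow> 'a::euclidean_space set \<Rightarrow> ('a \<Rightarrow> 'b::real_normed_vector) \<Rightarrow> bool" where
  "Ck_on 0 S f \<longleftrightarrow> continuous_on S f"
| "Ck_on (Suc k) S f \<longleftrightarrow> (\<forall>x\<in>S. f differentiable (at x)) \<and>
     (\<forall>v. Ck_on k S (\<lambda>x. frechet_derivative f (at x) v))"

text \<open>Intended for open \<open>S\<close> only, since the derivatives are two-sided.\<close>

definition smooth_on :: "'a::euclidean_space set \<Rightarrow> ('a \<Rightarrow> 'b::real_normed_vector) \<Rightarrow> bool" where
  "smooth_on S f \<longleftrightarrow> (\<forall>k. Ck_on k S f)"

definition antiderivative_on :: "real set \<Rightarrow> (real \<Rightarrow> real) \<Rightarrow> (real \<Rightarrow> real) \<Rightarrow> bool" where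
  "antiderivative_on S f F \<longleftrightarrow> (\<forall>x\<in>S. (F has_real_derivative f x) (at x))"

section \<open>Smooth and semi-Riemannian manifolds\<close>

text \<open>
  A smooth manifold modelled on the Euclidean space \<open>'e\<close> is a topological space with a smooth
  atlas. The atlas is a family of charts indexed by the set \<open>charts M\<close>, chart \<open>i\<close> having domain
  \<open>cdom M i\<close> and coordinate map \<open>coord M i\<close>; it need not be maximal.

  A chart identifies the tangent spaces over its domain with \<open>'e\<close>. Accordingly the metric is
  given by its local representatives: \<open>metric M i x v w\<close> is the value, at the point with
  coordinates \<open>x\<close> in chart \<open>i\<close>, on the tangent vectors with components \<open>v\<close> and \<open>w\<close> in that chart.
\<close>

record ('p, 'i, 'e) manifold =
  mtop :: "'p topology"
  charts :: "'i set"
  cdom :: "'i \<Rightarrow> 'p set"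
  coord :: "'i \<Rightarrow> 'p \<Rightarrow> 'e"

record ('p, 'i, 'e) semi_riemannian = "('p, 'i, 'e) manifold" +
  metric :: "'i \<Rightarrow> 'e \<Rightarrow> 'e \<Rightarrow> 'e \<Rightarrow> real"

definition chart_image :: "('p, 'i, 'e, 'm) manifold_scheme \<Rightarrow> 'i \<Rightarrow> 'e set" where
  "chart_image M i = coord M i ` cdom M i"

definition param :: "('p, 'i, 'e, 'm) manifold_scheme \<Rightarrow> 'i \<Rightarrow> 'e \<Rightarrow> 'p" where
  "param M i = inv_into (cdom M i) (coord M i)"

definition transition ::
    "('p, 'i, 'e, 'm) manifold_scheme \<Rightarrow> 'i \<Rightarrow> 'i \<Rightarrow> 'e \<Rightarrow> 'e" where
  "transition M i j = coord M j \<circ> param M i"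

definition overlap :: "('p, 'i, 'e, 'm) manifold_scheme \<Rightarrow> 'i \<Rightarrow> 'i \<Rightarrow> 'e set" where
  "overlap M i j = coord M i ` (cdom M i \<inter> cdom M j)"

definition smooth_manifold :: "('p, 'i, 'e::euclidean_space, 'm) manifold_scheme \<Rightarrow> bool" where
  "smooth_manifold M \<longleftrightarrow>
     topspace (mtop M) \<noteq> {} \<and> Hausdorff_space (mtop M) \<and> second_countable (mtop M) \<and>
     (\<Union>i\<in>charts M. cdom M i) = topspace (mtop M) \<and>
     (\<forall>i\<in>charts M. openin (mtop M) (cdom M i) \<and> open (chart_image M i) \<and>
        homeomorphic_map (subtopology (mtop M) (cdom M i)) (top_of_set (chart_image M i))
          (coord M i)) \<and>
     (\<forall>i\<in>charts M. \<forall>j\<in>charts M. smooth_on (overlap M i j) (transition M i j))"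

definition smooth_function ::
    "('p, 'i, 'e::euclidean_space, 'm) manifold_scheme \<Rightarrow> ('p \<Rightarrow> real) \<Rightarrow> bool" where
  "smooth_function M u \<longleftrightarrow> (\<forall>i\<in>charts M. smooth_on (chart_image M i) (u \<circ> param M i))"

text \<open>
  The last condition is the transformation law of a \<open>(0,2)\<close>-tensor under change of charts. The
  index of the metric is automatically constant on each connected component.
\<close>

definition semi_riemannian_manifold ::
    "('p, 'i, 'e::euclidean_space) semi_riemannian \<Rightarrow> bool" where
  "semi_riemannian_manifold M \<longleftrightarrow>
     smooth_manifold M \<and>
     (\<forall>i\<in>charts M. \<forall>x\<in>chart_image M i.
        bilinear (metric M i x) \<and>
        (\<forall>v w. metric M i x v w = metric M i x w v) \<and>
        (\<forall>v. (\<forall>w. metric M i x v w = 0) \<longrightarrow> v = 0)) \<and>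
     (\<forall>i\<in>charts M. \<forall>v w. smooth_on (chart_image M i) (\<lambda>x. metric M i x v w)) \<and>
     (\<forall>i\<in>charts M. \<forall>j\<in>charts M. \<forall>x\<in>overlap M i j. \<forall>v w.
        metric M i x v w =
        metric M j (transition M i j x)
          (frechet_derivative (transition M i j) (at x) v)
          (frechet_derivative (transition M i j) (at x) w))"

section \<open>Levi-Civita connection, curvature and Hessian in a chart\<close>

text \<open>
  Here \<open>g\<close> is the representative of a metric in one chart, and vectors \<open>u, v, w\<close> are regarded as
  constant (coordinate) vector fields, whose Lie brackets vanish.
\<close>

abbreviation dird :: "('e::euclidean_space \<Rightarrow> 'b::real_normed_vector) \<Rightarrow> 'e \<Rightarrow> 'e \<Rightarrow> 'b" where
  "dird f x v \<equiv> frechet_derivative f (at x) v"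

definition sharp ::
    "('e::euclidean_space \<Rightarrow> 'e \<Rightarrow> 'e \<Rightarrow> real) \<Rightarrow> 'e \<Rightarrow> ('e \<Rightarrow> real) \<Rightarrow> 'e" where
  "sharp g x l = (THE v. \<forall>w. g x v w = l w)"

text \<open>\<open>christoffel g x v w\<close> is \<open>\<nabla>\<^sub>v w\<close> at \<open>x\<close>, by the Koszul formula.\<close>

definition christoffel ::
    "('e::euclidean_space \<Rightarrow> 'e \<Rightarrow> 'e \<Rightarrow> real) \<Rightarrow> 'e \<Rightarrow> 'e \<Rightarrow> 'e \<Rightarrow> 'e" where
  "christoffel g x v w = sharp g x (\<lambda>z.
     (dird (\<lambda>y. g y w z) x v + dird (\<lambda>y. g y v z) x w - dird (\<lambda>y. g y v w) x z) / 2)"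

text \<open>\<open>R(u,v)w = \<nabla>\<^sub>u \<nabla>\<^sub>v w - \<nabla>\<^sub>v \<nabla>\<^sub>u w\<close>; with this sign round spheres have positive scalar
  curvature.\<close>

definition riemann ::
    "('e::euclidean_space \<Rightarrow> 'e \<Rightarrow> 'e \<Rightarrow> real) \<Rightarrow> 'e \<Rightarrow> 'e \<Rightarrow> 'e \<Rightarrow> 'e \<Rightarrow> 'e" where
  "riemann g x u v w =
     dird (\<lambda>y. christoffel g y v w) x u - dird (\<lambda>y. christoffel g y u w) x v
     + christoffel g x u (christoffel g x v w) - christoffel g x v (christoffel g x u w)"

definition endo_trace :: "('e::euclidean_space \<Rightarrow> 'e) \<Rightarrow> real" where
  "endo_trace T = (\<Sum>b\<in>Basis. T b \<bullet> b)"

definition ricci :: "('e::euclidean_space \<Rightarrow> 'e \<Rightarrow> 'e \<Rightarrow> real) \<Rightarrow> 'e \<Rightarrow> 'e \<Rightarrow> 'e \<Rightarrow> real" where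
  "ricci g x v w = endo_trace (\<lambda>u. riemann g x u v w)"

definition scalar_curvature :: "('e::euclidean_space \<Rightarrow> 'e \<Rightarrow> 'e \<Rightarrow> real) \<Rightarrow> 'e \<Rightarrow> real" where
  "scalar_curvature g x = endo_trace (\<lambda>v. sharp g x (ricci g x v))"

definition hessian ::
    "('e::euclidean_space \<Rightarrow> 'e \<Rightarrow> 'e \<Rightarrow> real) \<Rightarrow> ('e \<Rightarrow> real) \<Rightarrow> 'e \<Rightarrow> 'e \<Rightarrow> 'e \<Rightarrow> real" where
  "hessian g u x v w = dird (\<lambda>y. dird u y w) x v - dird u x (christoffel g x v w)"

definition constant_scalar_curvature ::
    "('p, 'i, 'e::euclidean_space) semi_riemannian \<Rightarrow> real \<Rightarrow> bool" where
  "constant_scalar_curvature M c \<longleftrightarrow>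
     (\<forall>i\<in>charts M. \<forall>x\<in>chart_image M i. scalar_curvature (metric M i) x = c)"

section \<open>Gradient Yamabe solitons\<close>

definition gradient_yamabe_soliton ::
    "('p, 'i, 'e::euclidean_space) semi_riemannian \<Rightarrow> ('p \<Rightarrow> real) \<Rightarrow> real \<Rightarrow> bool" where
  "gradient_yamabe_soliton M u \<rho> \<longleftrightarrow>
     semi_riemannian_manifold M \<and> smooth_function M u \<and>
     (\<forall>i\<in>charts M. \<forall>x\<in>chart_image M i. \<forall>v w.
        (scalar_curvature (metric M i) x - \<rho>) * metric M i x v w =
        hessian (metric M i) (u \<circ> param M i) x v w)"

definition steady_gradient_yamabe_soliton ::
    "('p, 'i, 'e::euclidean_space) semi_riemannian \<Rightarrow> ('p \<Rightarrow> real) \<Rightarrow> bool" where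
  "steady_gradient_yamabe_soliton M u \<longleftrightarrow> gradient_yamabe_soliton M u 0"

section \<open>Warped products over an open subset of a Euclidean space\<close>

definition flat_metric :: "('n::finite \<Rightarrow> real) \<Rightarrow> real^'n \<Rightarrow> real^'n \<Rightarrow> real" where
  "flat_metric \<epsilon> v w = (\<Sum>i\<in>UNIV. \<epsilon> i * v $ i * w $ i)"

text \<open>
  The manifold \<open>\<Omega> \<times> F\<close> with the metric \<open>g\<^sub>B + r\<^sup>2 g\<^sub>F\<close>. The open set \<open>\<Omega>\<close> carries its identity
  chart, so the charts of the product are indexed by those of \<open>F\<close>.
\<close>

definition warped_product ::
    "'b::euclidean_space set \<Rightarrow> ('b \<Rightarrow> 'b \<Rightarrow> 'b \<Rightarrow> real) \<Rightarrow> ('b \<Rightarrow> real) \<Rightarrow>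
     ('p, 'i, 'e::euclidean_space) semi_riemannian \<Rightarrow> ('b \<times> 'p, 'i, 'b \<times> 'e) semi_riemannian" where
  "warped_product \<Omega> gB r F =
     \<lparr> mtop = prod_topology (top_of_set \<Omega>) (mtop F),
       charts = charts F,
       cdom = (\<lambda>i. \<Omega> \<times> cdom F i),
       coord = (\<lambda>i (x, p). (x, coord F i p)),
       metric = (\<lambda>i (x, y) (v, w) (v', w'). gB x v v' + (r x)\<^sup>2 * metric F i y w w') \<rparr>"

end

theory Submission
  imports Defs
begin

text \<open>
  Write \<open>q = \<parallel>\<alpha>\<parallel>\<^sup>2\<close>. The Hessian of \<open>h \<circ> \<xi>\<close> with respect to \<open>g\<close> is a combination of the three
  tensors \<open>d\<xi> \<otimes> d\<xi>\<close>, \<open>\<delta>\<close> and \<open>g\<^sub>F\<close> (lemma \<open>hessian_potential\<close>), and these are linearly independent. The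
  steady soliton equation \<open>S g = Hess (h \<circ> \<xi>)\<close> is therefore equivalent to three scalar equations
  (lemma \<open>steady_iff_scalar_curvature\<close>):
  \<open>h'' + 2 h' \<phi>' / \<phi> = 0\<close>, \<open>S = - q h' \<phi> \<phi>'\<close> and \<open>S f = q h' \<phi>\<^sup>2 f'\<close>.

  The last two give \<open>(f \<phi>)' = 0\<close> without any knowledge of \<open>S\<close>, because \<open>q\<close>, \<open>h'\<close> and \<open>\<phi>\<close> do not vanish.
  Hence \<open>f = k2 / \<phi>\<close> and \<open>g = \<phi>\<^sup>-\<^sup>2 (\<delta> + k2\<^sup>2 g\<^sub>F)\<close> is conformal to a product whose scalar curvature is
  zero. Here the conformal factor is a function of the coordinate \<open>\<xi>\<close>, whose differential is
  parallel for the product metric, so the change of the curvature is explicit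
  (lemma \<open>scalar_curvature_conf\<close>). In total dimension six it gives
  \<open>S = q (10 \<phi> \<phi>'' - 30 \<phi>'\<^sup>2)\<close>.

  What remains is a system of ordinary differential equations. The first equation integrates to
  \<open>h' = k1 / \<phi>\<^sup>2\<close>, and the equation for \<open>S\<close> then has the first integral
  \<open>k3 = (k1 - 40 \<phi> \<phi>') / (20 \<phi>\<^sup>4)\<close> (lemma \<open>soliton_ode_iff\<close>), that is,
  \<open>40 \<phi> \<phi>' = k1 - 20 k3 \<phi>\<^sup>4\<close>. Separating variables yields the implicit integral for \<open>\<phi>\<close>. The right-hand
  side satisfies a linear homogeneous equation along a solution, so it vanishes either nowhere,
  and the separation is legitimate, or everywhere, and then \<open>\<phi>\<close> is constant
  (lemma \<open>implicit_integral_iff\<close>).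
\<close>

section \<open>Calculus of smooth maps\<close>

lemma dirdI: "(f has_derivative f') (at x) \<Longrightarrow> dird f x v = f' v"
  using frechet_derivative_at by metis

lemma has_derivative_dird: "f differentiable (at x) \<Longrightarrow> (f has_derivative dird f x) (at x)"
  by (simp add: frechet_derivative_works)

lemma dird_cong:
  assumes "open S" "x \<in> S" "\<And>y. y \<in> S \<Longrightarrow> f y = g y"
  shows "dird f x = dird g x"
proof -
  have "(f has_derivative D) (at x) \<longleftrightarrow> (g has_derivative D) (at x)" for D
    using assms by (metis has_derivative_transform_within_open)
  then show ?thesis by (simp add: frechet_derivative_def)
qed

lemma differentiable_cong:
  assumes "open S" "x \<in> S" "\<And>y. y \<in> S \<Longrightarrow> f y = g y"
  shows "f differentiable (at x) \<longleftrightarrow> g differentiable (at x)"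
  unfolding differentiable_def using assms by (metis has_derivative_transform_within_open)

lemma Ck_on_cong:
  assumes "open S" "\<And>y. y \<in> S \<Longrightarrow> f y = g y"
  shows "Ck_on k S f \<longleftrightarrow> Ck_on k S g"
  using assms(2)
proof (induction k arbitrary: f g)
  case 0
  then show ?case by (simp cong: continuous_on_cong)
next
  case (Suc k)
  have "dird f x v = dird g x v" if "x \<in> S" for x v
    using dird_cong[OF \<open>open S\<close> that, of f g] Suc.prems by simp
  then have "Ck_on k S (\<lambda>x. dird f x v) \<longleftrightarrow> Ck_on k S (\<lambda>x. dird g x v)" for v
    by (rule Suc.IH)
  moreover have "f differentiable (at x) \<longleftrightarrow> g differentiable (at x)" if "x \<in> S" for x
    using differentiable_cong[OF \<open>open S\<close> that, of f g] Suc.prems by simp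
  ultimately show ?case by simp
qed

text \<open>
  The derivative may be given by a formula that is valid on \<open>S\<close> only: since \<open>S\<close> is open, values
  outside \<open>S\<close> do not affect derivatives at points of \<open>S\<close>, although \<^const>\<open>frechet_derivative\<close> is a
  total function.
\<close>

lemma Ck_on_SucI:
  assumes "open S" "\<And>x. x \<in> S \<Longrightarrow> (f has_derivative f' x) (at x)"
    and "\<And>v. Ck_on k S (\<lambda>x. f' x v)"
  shows "Ck_on (Suc k) S f"
proof -
  have "dird f x v = f' x v" if "x \<in> S" for x v
    using dirdI[OF assms(2)[OF that]] .
  then have "Ck_on k S (\<lambda>x. dird f x v) \<longleftrightarrow> Ck_on k S (\<lambda>x. f' x v)" for v
    by (rule Ck_on_cong[OF assms(1)])
  then show ?thesis using assms(2,3) by (auto simp: differentiable_def)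
qed

lemma Ck_on_SucD:
  assumes "Ck_on (Suc k) S f"
  shows "x \<in> S \<Longrightarrow> (f has_derivative dird f x) (at x)" "Ck_on k S (\<lambda>x. dird f x v)"
  using assms by (auto intro: has_derivative_dird)

lemma Ck_on_Suc_imp: "Ck_on (Suc k) S f \<Longrightarrow> Ck_on k S f"
proof (induction k arbitrary: f)
  case 0
  then show ?case
    by (auto intro: continuous_at_imp_continuous_on differentiable_imp_continuous_within)
next
  case (Suc k)
  then show ?case by (meson Ck_on.simps(2))
qed

lemma Ck_on_const: "Ck_on k S (\<lambda>x. c)"
  by (induction k arbitrary: c) auto

lemma Ck_on_compose_linear:
  assumes L: "bounded_linear L" and "open T" and im: "\<And>x. x \<in> T \<Longrightarrow> L x \<in> S" and "Ck_on k S f"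
  shows "Ck_on k T (\<lambda>x. f (L x))"
  using assms(4)
proof (induction k arbitrary: f)
  case 0
  have "continuous_on T L" using L by (simp add: linear_continuous_on)
  moreover have "L ` T \<subseteq> S" using im by blast
  ultimately show ?case using 0 by (auto intro: continuous_on_compose2)
next
  case (Suc k)
  show ?case
  proof (rule Ck_on_SucI[OF \<open>open T\<close>])
    show "((\<lambda>x. f (L x)) has_derivative (\<lambda>v. dird f (L x) (L v))) (at x)" if "x \<in> T" for x
      using diff_chain_at[OF bounded_linear_imp_has_derivative[OF L] Ck_on_SucD(1)[OF Suc.prems im[OF that]]]
      by (simp add: comp_def)
    show "Ck_on k T (\<lambda>x. dird f (L x) (L v))" for v
      using Ck_on_SucD(2)[OF Suc.prems] by (rule Suc.IH)
  qed
qed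

lemma linear_compose_Ck_on:
  assumes L: "bounded_linear L" and "open S" and "Ck_on k S f"
  shows "Ck_on k S (\<lambda>x. L (f x))"
  using assms(3)
proof (induction k arbitrary: f)
  case 0
  then show ?case using L by (auto intro: bounded_linear.continuous_on)
next
  case (Suc k)
  show ?case
  proof (rule Ck_on_SucI[OF \<open>open S\<close>])
    show "((\<lambda>x. L (f x)) has_derivative (\<lambda>v. L (dird f x v))) (at x)" if "x \<in> S" for x
      using Ck_on_SucD(1)[OF Suc.prems that] by (rule bounded_linear.has_derivative[OF L])
    show "Ck_on k S (\<lambda>x. L (dird f x v))" for v
      using Ck_on_SucD(2)[OF Suc.prems] by (rule Suc.IH)
  qed
qed

lemma Ck_on_linear:
  assumes L: "bounded_linear L" and "open S"
  shows "Ck_on k S L"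
proof (cases k)
  case 0
  then show ?thesis using L by (simp add: linear_continuous_on)
next
  case (Suc m)
  show ?thesis unfolding Suc
    using bounded_linear_imp_has_derivative[OF L] Ck_on_const
    by (rule Ck_on_SucI[OF \<open>open S\<close>])
qed

lemma Ck_on_add:
  assumes "open S" "Ck_on k S f" "Ck_on k S g"
  shows "Ck_on k S (\<lambda>x. f x + g x)"
  using assms(2,3)
proof (induction k arbitrary: f g)
  case 0
  then show ?case by (auto intro: continuous_intros)
next
  case (Suc k)
  show ?case
  proof (rule Ck_on_SucI[OF \<open>open S\<close>])
    show "((\<lambda>x. f x + g x) has_derivative (\<lambda>v. dird f x v + dird g x v)) (at x)" if "x \<in> S" for x
      using Suc.prems[THEN Ck_on_SucD(1), OF that] by (rule has_derivative_add)
    show "Ck_on k S (\<lambda>x. dird f x v + dird g x v)" for v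
      using Suc.prems[THEN Ck_on_SucD(2)] by (rule Suc.IH)
  qed
qed

lemma Ck_on_mult:
  fixes f g :: "'a::euclidean_space \<Rightarrow> real"
  assumes "open S" "Ck_on k S f" "Ck_on k S g"
  shows "Ck_on k S (\<lambda>x. f x * g x)"
  using assms(2,3)
proof (induction k arbitrary: f g)
  case 0
  then show ?case by (auto intro: continuous_intros)
next
  case (Suc k)
  show ?case
  proof (rule Ck_on_SucI[OF \<open>open S\<close>])
    show "((\<lambda>x. f x * g x) has_derivative (\<lambda>v. f x * dird g x v + dird f x v * g x)) (at x)"
      if "x \<in> S" for x
      using Suc.prems[THEN Ck_on_SucD(1), OF that] by (rule has_derivative_mult)
    show "Ck_on k S (\<lambda>x. f x * dird g x v + dird f x v * g x)" for v
      by (intro Ck_on_add[OF \<open>open S\<close>] Suc.IH Suc.prems[THEN Ck_on_SucD(2)]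
          Suc.prems[THEN Ck_on_Suc_imp])
  qed
qed

lemma Ck_on_inverse:
  fixes f :: "'a::euclidean_space \<Rightarrow> real"
  assumes "open S" "Ck_on k S f" and nz: "\<And>x. x \<in> S \<Longrightarrow> f x \<noteq> 0"
  shows "Ck_on k S (\<lambda>x. inverse (f x))"
  using assms(2)
proof (induction k)
  case 0
  then show ?case using nz by (auto intro: continuous_intros)
next
  case (Suc k)
  show ?case
  proof (rule Ck_on_SucI[OF \<open>open S\<close>])
    show "((\<lambda>x. inverse (f x)) has_derivative
        (\<lambda>v. - 1 * (inverse (f x) * dird f x v * inverse (f x)))) (at x)" if "x \<in> S" for x
      using Deriv.has_derivative_inverse[OF nz[OF that] Ck_on_SucD(1)[OF Suc.prems that]] by simp
    show "Ck_on k S (\<lambda>x. - 1 * (inverse (f x) * dird f x v * inverse (f x)))" for v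
      by (intro Ck_on_mult[OF \<open>open S\<close>] Ck_on_const Suc.IH Ck_on_SucD(2)[OF Suc.prems]
          Ck_on_Suc_imp[OF Suc.prems])
  qed
qed

lemma smooth_on_differentiable: "smooth_on S f \<Longrightarrow> x \<in> S \<Longrightarrow> f differentiable (at x)"
  unfolding smooth_on_def by (meson Ck_on.simps(2))

lemma smooth_on_dird: "smooth_on S f \<Longrightarrow> smooth_on S (\<lambda>x. dird f x v)"
  unfolding smooth_on_def using Ck_on_SucD(2) by blast

lemma smooth_on_has_deriv:
  fixes f :: "real \<Rightarrow> real"
  shows "smooth_on S f \<Longrightarrow> t \<in> S \<Longrightarrow> (f has_real_derivative deriv f t) (at t)"
  by (meson DERIV_deriv_iff_real_differentiable smooth_on_differentiable)

lemma smooth_on_deriv: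
  fixes f :: "real \<Rightarrow> real"
  assumes "open S" "smooth_on S f"
  shows "smooth_on S (deriv f)"
proof -
  have "dird f x 1 = deriv f x" if "x \<in> S" for x
    using dirdI[of f "(*) (deriv f x)" x 1] smooth_on_has_deriv[OF assms(2) that]
    by (simp add: has_field_derivative_def)
  then show ?thesis
    using smooth_on_dird[OF assms(2), of 1] Ck_on_cong[OF assms(1), of "\<lambda>x. dird f x 1" "deriv f"]
    unfolding smooth_on_def by blast
qed

section \<open>Warped products are semi-Riemannian manifolds\<close>

lemma second_countable_euclidean_subset:
  "second_countable (top_of_set (S :: 'a::second_countable_topology set))"
proof -
  obtain B :: "'a set set" where B: "countable B" "topological_basis B"
    using ex_countable_basis by blast
  have "second_countable (euclidean :: 'a topology)"
    unfolding second_countable_def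
    using B by (intro exI[of _ B]) (auto simp: topological_basis_open intro: topological_basisE)
  then show ?thesis by (rule second_countable_subtopology)
qed

lemma second_countable_prod_topology:
  assumes "second_countable X" "second_countable Y"
  shows "second_countable (prod_topology X Y)"
proof -
  obtain A where A: "countable A" "\<forall>V\<in>A. openin X V"
      "\<forall>U x. openin X U \<and> x \<in> U \<longrightarrow> (\<exists>V\<in>A. x \<in> V \<and> V \<subseteq> U)"
    using assms(1) unfolding second_countable_def by (elim exE conjE)
  obtain B where B: "countable B" "\<forall>V\<in>B. openin Y V"
      "\<forall>U x. openin Y U \<and> x \<in> U \<longrightarrow> (\<exists>V\<in>B. x \<in> V \<and> V \<subseteq> U)"
    using assms(2) unfolding second_countable_def by (elim exE conjE)
  let ?C = "(\<lambda>(U, V). U \<times> V) ` (A \<times> B)"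
  have "countable ?C" using A B by blast
  moreover have "openin (prod_topology X Y) V" if "V \<in> ?C" for V
    using that A B by (auto simp: openin_prod_Times_iff)
  moreover have "\<exists>V\<in>?C. z \<in> V \<and> V \<subseteq> W" if "openin (prod_topology X Y) W" "z \<in> W" for W z
  proof -
    obtain x y where z: "z = (x, y)" by (cases z)
    have "\<forall>x y. (x, y) \<in> W \<longrightarrow>
        (\<exists>U V. openin X U \<and> openin Y V \<and> x \<in> U \<and> y \<in> V \<and> U \<times> V \<subseteq> W)"
      using that(1) by (simp only: openin_prod_topology_alt)
    then obtain U V where UV: "openin X U" "openin Y V" "x \<in> U" "y \<in> V" "U \<times> V \<subseteq> W"
      using \<open>z \<in> W\<close> z by meson
    obtain U' where U': "U' \<in> A" "x \<in> U'" "U' \<subseteq> U" using A(3) UV(1,3) by meson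
    obtain V' where V': "V' \<in> B" "y \<in> V'" "V' \<subseteq> V" using B(3) UV(2,4) by meson
    have "U' \<times> V' \<in> ?C" using U'(1) V'(1) by force
    moreover have "U' \<times> V' \<subseteq> W" using U'(3) V'(3) UV(5) by (meson Sigma_mono subset_trans)
    moreover have "z \<in> U' \<times> V'" using U'(2) V'(2) z by simp
    ultimately show ?thesis by (intro bexI[of _ "U' \<times> V'"] conjI)
  qed
  ultimately show ?thesis unfolding second_countable_def by (intro exI[of _ ?C]) simp
qed

lemma smooth_manifold_coord_inj:
  assumes "smooth_manifold M" "i \<in> charts M"
  shows "inj_on (coord M i) (cdom M i)"
proof -
  have "cdom M i \<subseteq> topspace (mtop M)"
    using assms unfolding smooth_manifold_def by blast
  moreover have "homeomorphic_map (subtopology (mtop M) (cdom M i)) (top_of_set (chart_image M i))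
          (coord M i)" using assms unfolding smooth_manifold_def by blast
  ultimately show ?thesis
    by (metis homeomorphic_imp_injective_map topspace_subtopology_subset)
qed

text \<open>
  Charts are homeomorphisms onto open sets, hence open maps. Openness is needed wherever a
  transition map is differentiated, because the derivatives are two-sided.
\<close>

lemma smooth_manifold_overlap_open:
  assumes "smooth_manifold M" "i \<in> charts M" "j \<in> charts M"
  shows "open (overlap M i j)"
proof -
  have i: "openin (mtop M) (cdom M i)" "open (chart_image M i)"
     "homeomorphic_map (subtopology (mtop M) (cdom M i)) (top_of_set (chart_image M i)) (coord M i)"
    using assms(1,2) unfolding smooth_manifold_def by auto
  have "openin (mtop M) (cdom M j)" using assms(1,3) unfolding smooth_manifold_def by auto
  then have "openin (subtopology (mtop M) (cdom M i)) (cdom M i \<inter> cdom M j)"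
    using i(1) by (simp add: openin_subtopology_Int2)
  then have "openin (top_of_set (chart_image M i)) (coord M i ` (cdom M i \<inter> cdom M j))"
    using i(3) homeomorphic_imp_open_map open_map_def by blast
  then show ?thesis unfolding overlap_def using i(2) openin_open_eq by blast
qed

lemma param_eq:
  assumes "smooth_manifold M" "i \<in> charts M" "p \<in> cdom M i"
  shows "param M i (coord M i p) = p"
  unfolding param_def using smooth_manifold_coord_inj[OF assms(1,2)] assms(3) by (rule inv_into_f_f)

context
  fixes \<Omega> :: "'b::euclidean_space set" and gB :: "'b \<Rightarrow> 'b \<Rightarrow> 'b \<Rightarrow> real" and r :: "'b \<Rightarrow> real"
    and F :: "('p, 'i, 'e::euclidean_space) semi_riemannian"
begin

private abbreviation (input) "W \<equiv> warped_product \<Omega> gB r F"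

lemma warped_product_simps:
  "mtop W = prod_topology (top_of_set \<Omega>) (mtop F)" "charts W = charts F"
  "cdom W i = \<Omega> \<times> cdom F i" "coord W i (x, p) = (x, coord F i p)"
  "metric W i (x, y) (v, w) (v', w') = gB x v v' + (r x)\<^sup>2 * metric F i y w w'"
  by (simp_all add: warped_product_def)

lemma warped_product_metric:
  "metric W i z V V' =
     gB (fst z) (fst V) (fst V') + (r (fst z))\<^sup>2 * metric F i (snd z) (snd V) (snd V')"
  by (cases z; cases V; cases V') (simp add: warped_product_simps)

lemma warped_product_chart_image: "chart_image W i = \<Omega> \<times> chart_image F i"
  by (force simp: chart_image_def warped_product_def)

lemma warped_product_overlap: "overlap W i j = \<Omega> \<times> overlap F i j"
  by (force simp: overlap_def warped_product_def)

context
  assumes F: "smooth_manifold F"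
begin

lemma warped_product_param:
  assumes "i \<in> charts F" "x \<in> \<Omega>" "y \<in> chart_image F i"
  shows "param W i (x, y) = (x, param F i y)"
proof -
  obtain p where p: "p \<in> cdom F i" "y = coord F i p" using assms(3) unfolding chart_image_def by auto
  have "inj_on (coord W i) (cdom W i)"
    using smooth_manifold_coord_inj[OF F assms(1)]
    by (auto simp: inj_on_def warped_product_def)
  then have "param W i (coord W i (x, p)) = (x, p)"
    unfolding param_def using assms(2) p by (intro inv_into_f_f) (auto simp: warped_product_simps)
  then show ?thesis using p param_eq[OF F assms(1)] by (simp add: warped_product_simps)
qed

lemma warped_product_transition:
  assumes "i \<in> charts F" "x \<in> \<Omega>" "y \<in> overlap F i j"
  shows "transition W i j (x, y) = (x, transition F i j y)"
proof -
  have "y \<in> chart_image F i" using assms(3) unfolding overlap_def chart_image_def by blast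
  then show ?thesis
    by (simp add: transition_def warped_product_param[OF assms(1,2)] warped_product_simps)
qed

text \<open>
  The charts are products of the identity with charts of \<open>F\<close>, so every transition map is the
  identity on the base factor and inherits its smoothness from a transition map of \<open>F\<close>.
\<close>

lemma smooth_manifold_warped_product:
  assumes "open \<Omega>" "\<Omega> \<noteq> {}"
  shows "smooth_manifold W"
proof -
  note Fd = F[unfolded smooth_manifold_def]
  have homeo: "homeomorphic_map (subtopology (mtop W) (cdom W i)) (top_of_set (chart_image W i)) (coord W i)"
    if i: "i \<in> charts F" for i
  proof -
    have "homeomorphic_map (subtopology (mtop F) (cdom F i)) (top_of_set (chart_image F i)) (coord F i)"
      using Fd i by blast
    then obtain k where "homeomorphic_maps (subtopology (mtop F) (cdom F i))
        (top_of_set (chart_image F i)) (coord F i) k"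
      using homeomorphic_map_maps by blast
    moreover have "homeomorphic_maps (top_of_set \<Omega>) (top_of_set \<Omega>) id id"
      by (simp only: homeomorphic_maps_id)
    ultimately have "homeomorphic_maps
        (prod_topology (top_of_set \<Omega>) (subtopology (mtop F) (cdom F i)))
        (prod_topology (top_of_set \<Omega>) (top_of_set (chart_image F i)))
        (\<lambda>(x, y). (id x, coord F i y)) (\<lambda>(x, y). (id x, k y))"
      unfolding homeomorphic_maps_prod by blast
    then have "homeomorphic_map
        (prod_topology (top_of_set \<Omega>) (subtopology (mtop F) (cdom F i)))
        (prod_topology (top_of_set \<Omega>) (top_of_set (chart_image F i)))
        (\<lambda>(x, y). (id x, coord F i y))"
      using homeomorphic_map_maps by blast
    moreover have "prod_topology (top_of_set \<Omega>) (top_of_set (chart_image F i))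
        = top_of_set (chart_image W i)"
      by (simp add: warped_product_chart_image)
    moreover have "prod_topology (top_of_set \<Omega>) (subtopology (mtop F) (cdom F i))
        = subtopology (mtop W) (cdom W i)"
      by (simp add: warped_product_simps subtopology_Times subtopology_subtopology)
    moreover have "(\<lambda>(x, y). (id x, coord F i y)) = coord W i"
      by (auto simp: warped_product_def)
    ultimately show ?thesis by simp
  qed
  have smooth: "smooth_on (overlap W i j) (transition W i j)"
    if ij: "i \<in> charts F" "j \<in> charts F" for i j
    unfolding smooth_on_def
  proof
    fix k
    have op: "open (overlap F i j)" using smooth_manifold_overlap_open[OF F ij] .
    then have opW: "open (overlap W i j)"
      unfolding warped_product_overlap using assms(1) by (simp add: open_Times)
    have tr: "Ck_on k (overlap F i j) (transition F i j)"
      using Fd ij unfolding smooth_on_def by blast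
    have "Ck_on k (overlap W i j) (\<lambda>z. transition F i j (snd z))"
      by (rule Ck_on_compose_linear[OF bounded_linear_snd opW _ tr])
        (auto simp: warped_product_overlap)
    then have "Ck_on k (overlap W i j) (\<lambda>z. (0 :: 'b, transition F i j (snd z)))"
      by (rule linear_compose_Ck_on[where L = "\<lambda>y. (0, y)", OF _ opW, rotated])
        (simp add: bounded_linear_Pair bounded_linear_zero bounded_linear_ident)
    moreover have "Ck_on k (overlap W i j) (\<lambda>z. (fst z, 0 :: 'e))"
      by (rule Ck_on_linear[OF _ opW])
        (simp add: bounded_linear_Pair bounded_linear_zero bounded_linear_fst)
    ultimately have "Ck_on k (overlap W i j) (\<lambda>z. (fst z, 0) + (0, transition F i j (snd z)))"
      by (intro Ck_on_add[OF opW])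
    moreover have "transition W i j z = (fst z, 0) + (0, transition F i j (snd z))"
      if "z \<in> overlap W i j" for z
      using that warped_product_transition[OF ij(1), where j = j, of "fst z" "snd z"]
      by (auto simp: warped_product_overlap)
    ultimately show "Ck_on k (overlap W i j) (transition W i j)"
      using Ck_on_cong[OF opW, of "transition W i j"] by simp
  qed
  have "Hausdorff_space (mtop W)" "second_countable (mtop W)" "topspace (mtop W) \<noteq> {}"
    using Fd assms
    by (auto simp: warped_product_simps Hausdorff_space_prod_topology Hausdorff_space_subtopology
        second_countable_prod_topology second_countable_euclidean_subset)
  moreover have "(\<Union>i\<in>charts W. cdom W i) = topspace (mtop W)"
    using Fd by (auto simp: warped_product_simps)
  moreover have "openin (mtop W) (cdom W i)" "open (chart_image W i)" if "i \<in> charts W" for i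
    using that Fd assms(1)
    by (auto simp: warped_product_simps openin_prod_Times_iff warped_product_chart_image open_Times)
  ultimately show ?thesis
    unfolding smooth_manifold_def using homeo smooth by (simp add: warped_product_simps(2))
qed

end

text \<open>
  The transformation law reduces to that of \<open>F\<close>: the base component of a tangent vector and the
  coefficient \<open>r\<close> are unchanged by a change of charts.
\<close>

lemma semi_riemannian_manifold_warped_product:
  assumes F: "semi_riemannian_manifold F" and \<Omega>: "open \<Omega>" "\<Omega> \<noteq> {}"
    and gB: "\<And>x. x \<in> \<Omega> \<Longrightarrow> bilinear (gB x)" "\<And>x v w. x \<in> \<Omega> \<Longrightarrow> gB x v w = gB x w v"
      "\<And>x v. x \<in> \<Omega> \<Longrightarrow> \<forall>w. gB x v w = 0 \<Longrightarrow> v = 0"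
      "\<And>v w. smooth_on \<Omega> (\<lambda>x. gB x v w)"
    and r: "smooth_on \<Omega> r" "\<And>x. x \<in> \<Omega> \<Longrightarrow> r x \<noteq> 0"
  shows "semi_riemannian_manifold W"
proof -
  have SF: "smooth_manifold F" using F unfolding semi_riemannian_manifold_def by blast
  have bil: "bilinear (metric F i y)" and sym: "metric F i y v w = metric F i y w v"
    and nondeg: "\<forall>w. metric F i y v w = 0 \<Longrightarrow> v = 0"
    if "i \<in> charts F" "y \<in> chart_image F i" for i y v w
    using F that unfolding semi_riemannian_manifold_def by blast+
  have "bilinear (metric W i z)" if i: "i \<in> charts F" and z: "z \<in> \<Omega> \<times> chart_image F i" for i z
  proof -
    have z': "fst z \<in> \<Omega>" "snd z \<in> chart_image F i" using z by auto
    note b = bil[OF i z'(2)] gB(1)[OF z'(1)]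
    show ?thesis
      unfolding bilinear_def linear_iff warped_product_metric
      by (auto simp: b[THEN bilinear_ladd] b[THEN bilinear_radd] b[THEN bilinear_lmul]
          b[THEN bilinear_rmul] algebra_simps)
  qed
  moreover have "metric W i z V V' = metric W i z V' V"
    if i: "i \<in> charts F" and z: "z \<in> \<Omega> \<times> chart_image F i" for i z V V'
  proof -
    have z': "fst z \<in> \<Omega>" "snd z \<in> chart_image F i" using z by auto
    show ?thesis unfolding warped_product_metric
      using gB(2)[OF z'(1)] sym[OF i z'(2)] by metis
  qed
  moreover have "V = 0" if i: "i \<in> charts F" and z: "z \<in> \<Omega> \<times> chart_image F i"
    and n: "\<forall>V'. metric W i z V V' = 0" for i z V
  proof -
    have z': "fst z \<in> \<Omega>" "snd z \<in> chart_image F i" using z by auto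
    note b = bil[OF i z'(2)] gB(1)[OF z'(1)]
    have "gB (fst z) (fst V) v = 0" for v
      using n[rule_format, of "(v, 0)"] by (simp add: warped_product_metric b[THEN bilinear_rzero])
    moreover have "metric F i (snd z) (snd V) v = 0" for v
      using n[rule_format, of "(0, v)"] r(2)[OF z'(1)]
      by (simp add: warped_product_metric b[THEN bilinear_rzero])
    ultimately have "fst V = 0" "snd V = 0" using gB(3)[OF z'(1)] nondeg[OF i z'(2)] by blast+
    then show ?thesis by (simp add: prod_eq_iff)
  qed
  moreover have "smooth_on (\<Omega> \<times> chart_image F i) (\<lambda>z. metric W i z V V')"
    if i: "i \<in> charts F" for i V V'
    unfolding smooth_on_def warped_product_metric
  proof
    fix k
    have op: "open (\<Omega> \<times> chart_image F i)"
      using \<Omega> i SF unfolding smooth_manifold_def by (simp add: open_Times)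
    have gB': "Ck_on k \<Omega> (\<lambda>x. gB x (fst V) (fst V'))" and r': "Ck_on k \<Omega> r"
      using gB(4) r(1) unfolding smooth_on_def by blast+
    have F': "Ck_on k (chart_image F i) (\<lambda>y. metric F i y (snd V) (snd V'))"
      using F i unfolding semi_riemannian_manifold_def smooth_on_def by blast
    show "Ck_on k (\<Omega> \<times> chart_image F i) (\<lambda>z. gB (fst z) (fst V) (fst V') +
        (r (fst z))\<^sup>2 * metric F i (snd z) (snd V) (snd V'))"
      unfolding power2_eq_square
      by (intro Ck_on_add[OF op] Ck_on_mult[OF op]
          Ck_on_compose_linear[OF bounded_linear_fst op _ gB']
          Ck_on_compose_linear[OF bounded_linear_fst op _ r']
          Ck_on_compose_linear[OF bounded_linear_snd op _ F']) auto
  qed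
  moreover have "metric W i z V V' =
        metric W j (transition W i j z) (dird (transition W i j) z V) (dird (transition W i j) z V')"
    if ij: "i \<in> charts F" "j \<in> charts F" and z: "z \<in> \<Omega> \<times> overlap F i j" for i j z V V'
  proof -
    have z': "fst z \<in> \<Omega>" "snd z \<in> overlap F i j" using z by auto
    let ?\<tau> = "transition F i j"
    have op: "open (\<Omega> \<times> overlap F i j)"
      using \<Omega> smooth_manifold_overlap_open[OF SF ij] by (simp add: open_Times)
    have t: "transition W i j y = (fst y, ?\<tau> (snd y))" if "y \<in> \<Omega> \<times> overlap F i j" for y
      using that warped_product_transition[OF SF ij(1), where j = j, of "fst y" "snd y"] by auto
    have "smooth_on (overlap F i j) ?\<tau>" using SF ij unfolding smooth_manifold_def by blast
    then have D: "(?\<tau> has_derivative dird ?\<tau> (snd z)) (at (snd z))"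
      using z'(2) by (intro has_derivative_dird smooth_on_differentiable)
    have "((\<lambda>y. ?\<tau> (snd y)) has_derivative (\<lambda>V. dird ?\<tau> (snd z) (snd V))) (at z)"
      using diff_chain_at[OF bounded_linear_imp_has_derivative[OF bounded_linear_snd] D]
      by (simp add: comp_def)
    then have "((\<lambda>y. (fst y, ?\<tau> (snd y))) has_derivative
        (\<lambda>V. (fst V, dird ?\<tau> (snd z) (snd V)))) (at z)"
      by (intro has_derivative_Pair bounded_linear_imp_has_derivative[OF bounded_linear_fst])
    then have "(transition W i j has_derivative (\<lambda>V. (fst V, dird ?\<tau> (snd z) (snd V)))) (at z)"
      by (rule has_derivative_transform_within_open[OF _ op z]) (simp add: t)
    then have d: "dird (transition W i j) z V = (fst V, dird ?\<tau> (snd z) (snd V))" for V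
      by (rule dirdI)
    have "metric F i (snd z) (snd V) (snd V') = metric F j (?\<tau> (snd z))
        (dird ?\<tau> (snd z) (snd V)) (dird ?\<tau> (snd z) (snd V'))"
      using F ij z'(2) unfolding semi_riemannian_manifold_def by blast
    then show ?thesis unfolding d t[OF z] warped_product_metric by simp
  qed
  ultimately show ?thesis
    unfolding semi_riemannian_manifold_def
    using smooth_manifold_warped_product[OF SF \<Omega>]
    by (simp add: warped_product_simps(2) warped_product_chart_image warped_product_overlap)
qed

end

section \<open>The Levi-Civita connection of a metric in a chart\<close>

text \<open>
  Where \<open>e\<close> vanishes, the first-order expansion of the product only sees the value of the other
  factor, so continuity of that factor suffices.
\<close>

lemma differentiable_mult_vanishing:
  fixes f e :: "'a::euclidean_space \<Rightarrow> real"
  assumes f: "isCont f x" and e: "e differentiable (at x)" and "e x = 0"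
  shows "(\<lambda>y. f y * e y) differentiable (at x)"
proof -
  have e': "(e has_derivative dird e x) (at x)" using has_derivative_dird[OF e] .
  then obtain K where K: "\<And>h. norm (dird e x h) \<le> norm h * K" "K > 0"
    using has_derivative_bounded_linear bounded_linear.pos_bounded by blast
  obtain d where d: "d > 0" "\<And>y. norm (y - x) < d \<Longrightarrow> norm (e y - e x - dird e x (y - x)) \<le> 1 * norm (y - x)"
    using e' unfolding has_derivative_at_alt by (meson zero_less_one)
  have lip: "norm (e y) \<le> (1 + K) * norm (y - x)" if "norm (y - x) < d" for y
    using d(2)[OF that] K(1)[of "y - x"] \<open>e x = 0\<close> by (simp add: algebra_simps)
  have "((\<lambda>y. (f y - f x) * e y) has_derivative (\<lambda>h. 0)) (at x)"
    unfolding has_derivative_at_alt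
  proof (intro conjI allI impI)
    fix \<epsilon> :: real assume "\<epsilon> > 0"
    then have "\<epsilon> / (1 + K) > 0" using K(2) by simp
    then obtain d' where d': "d' > 0" "\<And>y. norm (y - x) < d' \<Longrightarrow> norm (f y - f x) < \<epsilon> / (1 + K)"
      using f unfolding continuous_at_eps_delta dist_norm by blast
    have "norm ((f y - f x) * e y - (f x - f x) * e x - 0) \<le> \<epsilon> * norm (y - x)"
      if "norm (y - x) < min d d'" for y
    proof -
      have "norm ((f y - f x) * e y) \<le> (\<epsilon> / (1 + K)) * ((1 + K) * norm (y - x))"
        unfolding norm_mult using that d'(2)[of y] lip[of y] K(2)
        by (intro mult_mono) auto
      then show ?thesis using K(2) by simp
    qed
    then show "\<exists>d>0. \<forall>y. norm (y - x) < d \<longrightarrow>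
        norm ((f y - f x) * e y - (f x - f x) * e x - 0) \<le> \<epsilon> * norm (y - x)"
      using d(1) d'(1) by (intro exI[of _ "min d d'"]) auto
  qed simp
  then have "((\<lambda>y. (f y - f x) * e y + f x * e y) has_derivative (\<lambda>h. 0 + f x * dird e x h)) (at x)"
    by (intro has_derivative_add has_derivative_mult_right e')
  then show ?thesis by (auto simp: differentiable_def algebra_simps)
qed

text \<open>
  The representative of a metric in one chart, with exactly the regularity that the curvature
  tensor requires: two derivatives of the metric, hence one of the Christoffel symbols.
\<close>

locale chart_metric =
  fixes S :: "'e::euclidean_space set" and g :: "'e \<Rightarrow> 'e \<Rightarrow> 'e \<Rightarrow> real"
  assumes open_dom: "open S"
    and bilinear_metric: "x \<in> S \<Longrightarrow> bilinear (g x)"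
    and metric_sym: "x \<in> S \<Longrightarrow> g x v w = g x w v"
    and nondegenerate: "x \<in> S \<Longrightarrow> \<forall>w. g x v w = 0 \<Longrightarrow> v = 0"
    and metric_differentiable: "x \<in> S \<Longrightarrow> (\<lambda>y. g y v w) differentiable (at x)"
    and metric_differentiable2: "x \<in> S \<Longrightarrow> (\<lambda>y. dird (\<lambda>y. g y v w) y u) differentiable (at x)"
begin

abbreviation dg where "dg x u v w \<equiv> dird (\<lambda>y. g y v w) x u"
abbreviation \<Gamma> where "\<Gamma> \<equiv> christoffel g"

definition koszul where "koszul x v w z = (dg x v w z + dg x w v z - dg x z v w) / 2"

lemma metric_linear_simps:
  assumes "x \<in> S"
  shows "g x (v + v') w = g x v w + g x v' w" "g x w (v + v') = g x w v + g x w v'"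
    "g x (v - v') w = g x v w - g x v' w" "g x w (v - v') = g x w v - g x w v'"
    "g x (c *\<^sub>R v) w = c * g x v w" "g x w (c *\<^sub>R v) = c * g x w v"
    "g x 0 w = 0" "g x w 0 = 0" "g x (- v) w = - g x v w" "g x w (- v) = - g x w v"
    "g x (sum f A) w = (\<Sum>a\<in>A. g x (f a) w)" "g x w (sum f A) = (\<Sum>a\<in>A. g x w (f a))"
proof -
  have l: "linear (g x w)" "linear (\<lambda>v. g x v w)" for w
    using bilinear_metric[OF assms] unfolding bilinear_def by auto
  show "g x (v + v') w = g x v w + g x v' w" "g x (v - v') w = g x v w - g x v' w"
    "g x (c *\<^sub>R v) w = c * g x v w" "g x 0 w = 0" "g x (- v) w = - g x v w"
    "g x (sum f A) w = (\<Sum>a\<in>A. g x (f a) w)"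
    using linear_add[OF l(2)] linear_diff[OF l(2)] linear_scale[OF l(2)] linear_0[OF l(2)]
      linear_neg[OF l(2)] linear_sum[OF l(2)] by simp_all
  show "g x w (v + v') = g x w v + g x w v'" "g x w (v - v') = g x w v - g x w v'"
    "g x w (c *\<^sub>R v) = c * g x w v" "g x w 0 = 0" "g x w (- v) = - g x w v"
    "g x w (sum f A) = (\<Sum>a\<in>A. g x w (f a))"
    using linear_add[OF l(1)] linear_diff[OF l(1)] linear_scale[OF l(1)] linear_0[OF l(1)]
      linear_neg[OF l(1)] linear_sum[OF l(1)] by simp_all
qed

lemma metric_eqI:
  assumes "x \<in> S" "\<And>w. g x v w = g x v' w"
  shows "v = v'"
  using nondegenerate[OF assms(1), of "v - v'"] assms by (simp add: metric_linear_simps)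

lemma sharp_unique:
  assumes "x \<in> S" "\<And>w. g x v w = l w"
  shows "sharp g x l = v"
  unfolding sharp_def
  by (rule the_equality) (use assms metric_eqI in auto)

text \<open>
  In a finite-dimensional space nondegeneracy makes \<open>v \<mapsto> g(v, \<cdot>)\<close> injective, hence surjective onto
  the linear forms.
\<close>

lemma metric_sharp:
  assumes "x \<in> S" "linear l"
  shows "g x (sharp g x l) w = l w"
proof -
  let ?T = "\<lambda>v. \<Sum>b\<in>Basis. g x v b *\<^sub>R b"
  have lin: "linear ?T"
    by (rule linearI)
      (simp_all add: metric_linear_simps[OF assms(1)] scaleR_add_left sum.distrib scaleR_sum_right)
  have inner: "?T v \<bullet> b = g x v b" if "b \<in> Basis" for v b
    using that by (simp add: inner_sum_left inner_Basis if_distrib[of "(*) _"] cong: if_cong)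
  have "inj ?T"
  proof (rule linear_injective_0[OF lin, THEN iffD2], intro allI impI)
    fix v assume "?T v = 0"
    then have "g x v b = 0" if "b \<in> Basis" for b using inner[OF that, of v] by simp
    moreover have "linear (g x v)" using bilinear_metric[OF assms(1)] unfolding bilinear_def by auto
    ultimately have "g x v = (\<lambda>w. 0)"
      by (intro linear_eq_stdbasis) (auto simp: linear_zero)
    then show "v = 0" using nondegenerate[OF assms(1)] by metis
  qed
  then have "surj ?T" using linear_injective_imp_surjective[OF lin] by blast
  then have "\<exists>v. (\<Sum>b\<in>Basis. l b *\<^sub>R b) = ?T v" by (rule surjD)
  then obtain v where v: "?T v = (\<Sum>b\<in>Basis. l b *\<^sub>R b)" by (elim exE) simp
  have "g x v b = l b" if "b \<in> Basis" for b
    using inner[OF that, of v] that unfolding v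
    by (simp add: inner_sum_left inner_Basis if_distrib[of "(*) _"] cong: if_cong)
  moreover have "linear (g x v)" using bilinear_metric[OF assms(1)] unfolding bilinear_def by auto
  ultimately have *: "g x v = l" using assms(2) by (intro linear_eq_stdbasis) auto
  then have "sharp g x l = v" using sharp_unique[OF assms(1), of v l] by simp
  then show ?thesis using * by simp
qed

lemma dg_has_derivative: "x \<in> S \<Longrightarrow> ((\<lambda>y. g y v w) has_derivative (\<lambda>u. dg x u v w)) (at x)"
  using has_derivative_dird[OF metric_differentiable] by blast

lemma dg_linear:
  assumes x: "x \<in> S"
  shows "dg x (u + u') v w = dg x u v w + dg x u' v w" "dg x (c *\<^sub>R u) v w = c * dg x u v w"
    "dg x u (v + v') w = dg x u v w + dg x u v' w" "dg x u (c *\<^sub>R v) w = c * dg x u v w"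
    "dg x u v (w + w') = dg x u v w + dg x u v w'" "dg x u v (c *\<^sub>R w) = c * dg x u v w"
proof -
  have "linear (\<lambda>u. dg x u v w)" using linear_frechet_derivative[OF metric_differentiable[OF x]] .
  then show "dg x (u + u') v w = dg x u v w + dg x u' v w" "dg x (c *\<^sub>R u) v w = c * dg x u v w"
    by (simp_all add: linear_add linear_scale)
  note D = dg_has_derivative[OF x]
  have tr: "dird (\<lambda>y. g y a b) x u = D' u" if "(f has_derivative D') (at x)"
      and "\<And>y. y \<in> S \<Longrightarrow> f y = g y a b" for f D' a b
    using dirdI[OF has_derivative_transform_within_open[OF that(1) open_dom x that(2)]] by simp
  show "dg x u (v + v') w = dg x u v w + dg x u v' w"
    by (rule tr[OF has_derivative_add[OF D D]]) (simp add: metric_linear_simps)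
  show "dg x u v (w + w') = dg x u v w + dg x u v w'"
    by (rule tr[OF has_derivative_add[OF D D]]) (simp add: metric_linear_simps)
  show "dg x u (c *\<^sub>R v) w = c * dg x u v w"
    by (rule tr[OF has_derivative_mult_right[OF D]]) (simp add: metric_linear_simps)
  show "dg x u v (c *\<^sub>R w) = c * dg x u v w"
    by (rule tr[OF has_derivative_mult_right[OF D]]) (simp add: metric_linear_simps)
qed

lemma dg_sym: "x \<in> S \<Longrightarrow> dg x u v w = dg x u w v"
  using dird_cong[OF open_dom, of x "\<lambda>y. g y v w" "\<lambda>y. g y w v"] metric_sym by simp

lemma koszul_linear:
  assumes "x \<in> S"
  shows "linear (koszul x v w)"
  by (rule linearI) (simp_all add: koszul_def dg_linear[OF assms] field_simps)

lemma christoffel_unique: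
  assumes "x \<in> S" "\<And>z. g x c z = koszul x v w z"
  shows "\<Gamma> x v w = c"
  unfolding christoffel_def using assms(2) unfolding koszul_def by (rule sharp_unique[OF assms(1)])

lemma metric_christoffel:
  assumes "x \<in> S"
  shows "g x (\<Gamma> x v w) z = koszul x v w z"
  unfolding christoffel_def
  using metric_sharp[OF assms koszul_linear[OF assms, of v w]] unfolding koszul_def by simp

lemma christoffel_sym: "x \<in> S \<Longrightarrow> \<Gamma> x v w = \<Gamma> x w v"
  by (rule christoffel_unique) (simp_all add: metric_christoffel koszul_def dg_sym[of x v w])

lemma christoffel_linear:
  assumes "x \<in> S"
  shows "linear (\<Gamma> x v)"
proof (rule linearI)
  fix w w' show "\<Gamma> x v (w + w') = \<Gamma> x v w + \<Gamma> x v w'"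
    by (rule christoffel_unique[OF assms])
      (simp add: metric_linear_simps[OF assms] metric_christoffel[OF assms] koszul_def
        dg_linear[OF assms] field_simps)
next
  fix c w show "\<Gamma> x v (c *\<^sub>R w) = c *\<^sub>R \<Gamma> x v w"
    by (rule christoffel_unique[OF assms])
      (simp add: metric_linear_simps[OF assms] metric_christoffel[OF assms] koszul_def
        dg_linear[OF assms] field_simps)
qed

lemma metric_compatible:
  assumes "x \<in> S"
  shows "dg x u v w = g x (\<Gamma> x u v) w + g x v (\<Gamma> x u w)"
  using dg_sym[OF assms, of v w u] dg_sym[OF assms, of u v w] dg_sym[OF assms, of u w v]
  by (simp add: metric_sym[OF assms, of v] metric_christoffel[OF assms] koszul_def field_simps)

text \<open>
  Differentiability of the solution \<open>c y\<close> of \<open>g\<^sub>y(c y, \<cdot>) = l\<^sub>y\<close> at \<open>x\<close>, without determinants. Rewriting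
  the equation with the fixed form \<open>g\<^sub>x\<close> gives \<open>c = B - R\<close>, where \<open>B\<close> is differentiable and \<open>R\<close> is
  linear in \<open>c\<close> with coefficients \<open>e\<close> that are differentiable and vanish at \<open>x\<close>. The smallness of \<open>R\<close>
  first bounds \<open>c\<close> and makes it continuous at \<open>x\<close>; then \<open>R\<close> is differentiable by
  \<open>differentiable_mult_vanishing\<close>.
\<close>

lemma sharp_differentiable:
  assumes x: "x \<in> S" and lin: "\<And>y. y \<in> S \<Longrightarrow> linear (l y)"
    and diff: "\<And>w. (\<lambda>y. l y w) differentiable (at x)"
  shows "(\<lambda>y. sharp g y (l y)) differentiable (at x)"
proof -
  define c where "c y = sharp g y (l y)" for y
  define M where "M b = sharp g x ((\<bullet>) b)" for b :: 'e
  define e where "e a b y = g y a b - g x a b" for a b y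
  define B where "B y = (\<Sum>b\<in>Basis. l y b *\<^sub>R M b)" for y
  have M: "g x (M b) w = b \<bullet> w" for b w
    unfolding M_def by (rule metric_sharp[OF x])
      (simp add: bounded_linear.linear bounded_linear_inner_right)
  have expand: "(\<Sum>b\<in>Basis. g x v b *\<^sub>R M b) = v" for v
  proof (rule metric_eqI[OF x])
    fix w
    have "g x v w = g x v (\<Sum>b\<in>Basis. (w \<bullet> b) *\<^sub>R b)" by (simp add: euclidean_representation)
    also have "\<dots> = (\<Sum>b\<in>Basis. (w \<bullet> b) * g x v b)" by (simp add: metric_linear_simps[OF x])
    finally show "g x (\<Sum>b\<in>Basis. g x v b *\<^sub>R M b) w = g x v w"
      by (simp add: metric_linear_simps[OF x] M inner_commute mult.commute)
  qed
  define R where "R y = (\<Sum>b\<in>Basis. \<Sum>a\<in>Basis. ((c y \<bullet> a) * e a b y) *\<^sub>R M b)" for y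
  \<comment> \<open>\<open>M\<close> inverts the fixed form \<open>g\<^sub>x\<close>; \<open>R\<close> collects the error of replacing \<open>g\<^sub>y\<close> by \<open>g\<^sub>x\<close>.\<close>
  have fixpoint: "c y = B y - R y"
    if y: "y \<in> S" for y
  proof -
    have "g x (c y) b = l y b - (\<Sum>a\<in>Basis. (c y \<bullet> a) * e a b y)" for b
    proof -
      have "(\<Sum>a\<in>Basis. (c y \<bullet> a) * e a b y) =
          g y (\<Sum>a\<in>Basis. (c y \<bullet> a) *\<^sub>R a) b - g x (\<Sum>a\<in>Basis. (c y \<bullet> a) *\<^sub>R a) b"
        by (simp add: metric_linear_simps[OF x] metric_linear_simps[OF y] e_def
            right_diff_distrib sum_subtractf)
      also have "\<dots> = l y b - g x (c y) b"
        using metric_sharp[OF y lin[OF y]] by (simp add: euclidean_representation c_def)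
      finally show ?thesis by simp
    qed
    then have "c y = (\<Sum>b\<in>Basis. (l y b - (\<Sum>a\<in>Basis. (c y \<bullet> a) * e a b y)) *\<^sub>R M b)"
      using expand[of "c y"] by simp
    then show ?thesis
      by (simp add: B_def R_def scaleR_diff_left sum_subtractf scaleR_sum_left)
  qed
  have Bd: "B differentiable (at x)" unfolding B_def using diff by (auto intro!: derivative_intros)
  have ed: "e a b differentiable (at x)" for a b
    unfolding e_def using metric_differentiable[OF x] by (auto intro!: derivative_intros)
  have e0: "e a b x = 0" for a b by (simp add: e_def)
  have nhd: "\<forall>\<^sub>F y in at x. y \<in> S" using open_dom x eventually_at_topological by blast
  have cont: "isCont c x"
  proof -
    define E where "E y = (\<Sum>b\<in>Basis. \<Sum>a\<in>Basis. \<bar>e a b y\<bar> * norm (M b))" for y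
    have cB: "isCont B x" using Bd differentiable_imp_continuous_within by blast
    have ce: "isCont (e a b) x" for a b using ed differentiable_imp_continuous_within by blast
    have "isCont E x" unfolding E_def using ce by (auto intro!: continuous_intros)
    moreover have "E x = 0" by (simp add: E_def e0)
    ultimately have E0: "(E \<longlongrightarrow> 0) (at x)" by (simp add: isCont_def)
    have bound: "norm (c y - B y) \<le> norm (c y) * E y" if "y \<in> S" for y
    proof -
      have "c y - B y = - R y" by (simp add: fixpoint[OF that])
      then have "norm (c y - B y) = norm (R y)" by (simp only: norm_minus_cancel)
      also have "\<dots> \<le> (\<Sum>b\<in>Basis. \<Sum>a\<in>Basis. norm (((c y \<bullet> a) * e a b y) *\<^sub>R M b))"
        unfolding R_def by (intro order.trans[OF norm_sum] sum_mono) simp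
      also have "\<dots> \<le> (\<Sum>b\<in>Basis. \<Sum>a\<in>Basis. norm (c y) * (\<bar>e a b y\<bar> * norm (M b)))"
        by (intro sum_mono) (auto simp: abs_mult mult.assoc intro!: mult_right_mono Basis_le_norm)
      finally show ?thesis by (simp add: E_def sum_distrib_left)
    qed
    have "\<forall>\<^sub>F y in at x. norm (c y - B y) \<le> 2 * norm (B y) * E y"
    proof -
      have "\<forall>\<^sub>F y in at x. E y < 1/2" using E0 by (rule order_tendstoD) simp
      then show ?thesis using nhd
      proof eventually_elim
        case (elim y)
        have E: "0 \<le> E y" by (auto simp: E_def intro!: sum_nonneg)
        have "norm (c y) \<le> norm (B y) + norm (c y - B y)" by norm
        also have "\<dots> \<le> norm (B y) + norm (c y) * E y" using bound elim by simp
        also have "norm (c y) * E y \<le> norm (c y) * (1/2)" using elim by (intro mult_left_mono) auto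
        finally have "norm (c y) \<le> 2 * norm (B y)" by simp
        then have "norm (c y) * E y \<le> 2 * norm (B y) * E y" using E by (rule mult_right_mono)
        then show ?case using bound elim by fastforce
      qed
    qed
    moreover have "((\<lambda>y. 2 * norm (B y) * E y) \<longlongrightarrow> 2 * norm (B x) * 0) (at x)"
      using E0 cB unfolding isCont_def by (intro tendsto_intros)
    ultimately have "((\<lambda>y. c y - B y) \<longlongrightarrow> 0) (at x)"
      using Lim_null_comparison by fastforce
    moreover have "(B \<longlongrightarrow> B x) (at x)" using cB by (simp add: isCont_def)
    ultimately have "((\<lambda>y. (c y - B y) + B y) \<longlongrightarrow> 0 + B x) (at x)" by (rule tendsto_add)
    moreover have "B x = c x" using fixpoint[OF x] by (simp add: R_def e0)
    ultimately show ?thesis by (simp add: isCont_def)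
  qed
  have "(\<lambda>y. (c y \<bullet> a) * e a b y) differentiable (at x)" for a b
    using cont ed e0 by (intro differentiable_mult_vanishing) (auto intro: continuous_intros)
  then have "(\<lambda>y. B y - R y) differentiable (at x)"
    unfolding R_def using Bd by (auto intro!: derivative_intros)
  then show ?thesis
    using differentiable_cong[OF open_dom x fixpoint] by (simp add: c_def)
qed

lemma christoffel_differentiable:
  assumes "x \<in> S"
  shows "(\<lambda>y. \<Gamma> y v w) differentiable (at x)"
proof -
  have "(\<lambda>y. \<Gamma> y v w) = (\<lambda>y. sharp g y (koszul y v w))"
    unfolding christoffel_def koszul_def ..
  moreover have "(\<lambda>y. koszul y v w z) differentiable (at x)" for z
    unfolding koszul_def using metric_differentiable2[OF assms]
    by (auto intro!: derivative_intros)
  ultimately show ?thesis using sharp_differentiable[OF assms koszul_linear] by simp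
qed

lemma dird_christoffel_linear:
  assumes x: "x \<in> S"
  shows "linear (\<lambda>w. dird (\<lambda>y. \<Gamma> y v w) x u)"
proof -
  note D = has_derivative_dird[OF christoffel_differentiable[OF x]]
  have tr: "dird (\<lambda>y. \<Gamma> y v w) x u = D' u" if "(f has_derivative D') (at x)"
      and "\<And>y. y \<in> S \<Longrightarrow> f y = \<Gamma> y v w" for f D' w
    using dirdI[OF has_derivative_transform_within_open[OF that(1) open_dom x that(2)]] by simp
  show ?thesis
  proof (rule linearI)
    fix w w' show "dird (\<lambda>y. \<Gamma> y v (w + w')) x u = dird (\<lambda>y. \<Gamma> y v w) x u + dird (\<lambda>y. \<Gamma> y v w') x u"
      by (rule tr[OF has_derivative_add[OF D D]]) (simp add: linear_add[OF christoffel_linear])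
  next
    fix c w show "dird (\<lambda>y. \<Gamma> y v (c *\<^sub>R w)) x u = c *\<^sub>R dird (\<lambda>y. \<Gamma> y v w) x u"
      by (rule tr[OF has_derivative_scaleR_right[OF D]])
        (simp add: linear_scale[OF christoffel_linear])
  qed
qed

lemma ricci_linear:
  assumes "x \<in> S"
  shows "linear (ricci g x v)"
proof -
  note L = dird_christoffel_linear[OF assms] christoffel_linear[OF assms]
  have "linear (\<lambda>w. riemann g x u v w)" for u
    unfolding riemann_def
    by (rule linearI)
      (simp_all add: L[THEN linear_add] L[THEN linear_scale] algebra_simps)
  then show ?thesis
    unfolding ricci_def endo_trace_def
    by (intro linearI)
      (simp_all add: linear_add linear_scale inner_add_left sum.distrib sum_distrib_left)
qed

end

lemma semi_riemannian_chart_metric: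
  assumes M: "semi_riemannian_manifold M" and i: "i \<in> charts M"
  shows "chart_metric (chart_image M i) (metric M i)"
proof
  show "open (chart_image M i)"
    using M i unfolding semi_riemannian_manifold_def smooth_manifold_def by blast
  have s: "smooth_on (chart_image M i) (\<lambda>x. metric M i x v w)" for v w
    using M i unfolding semi_riemannian_manifold_def by blast
  fix x assume x: "x \<in> chart_image M i"
  show "bilinear (metric M i x)" "metric M i x v w = metric M i x w v"
    "\<forall>w. metric M i x v w = 0 \<Longrightarrow> v = 0" for v w
    using M i x unfolding semi_riemannian_manifold_def by blast+
  show "(\<lambda>y. metric M i y v w) differentiable (at x)"
    "(\<lambda>y. dird (\<lambda>y. metric M i y v w) y u) differentiable (at x)" for u v w
    using smooth_on_differentiable[OF s x] smooth_on_differentiable[OF smooth_on_dird[OF s] x] .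
qed

section \<open>Conformal change along a parallel gradient\<close>

lemma endo_trace_add: "endo_trace (\<lambda>u. A u + B u) = endo_trace A + endo_trace B"
  by (simp add: endo_trace_def inner_add_left sum.distrib)

lemma endo_trace_diff: "endo_trace (\<lambda>u. A u - B u) = endo_trace A - endo_trace B"
  by (simp add: endo_trace_def inner_diff_left sum_subtractf)

lemma endo_trace_scale: "endo_trace (\<lambda>u. c *\<^sub>R A u) = c * endo_trace A"
  by (simp add: endo_trace_def sum_distrib_left)

lemma endo_trace_ident: "endo_trace (\<lambda>u::'e::euclidean_space. u) = DIM('e)"
  by (simp add: endo_trace_def)

lemma endo_trace_rank_one:
  assumes "linear l"
  shows "endo_trace (\<lambda>u. l u *\<^sub>R v) = l v"
proof -
  have "l v = l (\<Sum>b\<in>Basis. (v \<bullet> b) *\<^sub>R b)" by (simp add: euclidean_representation)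
  also have "\<dots> = (\<Sum>b\<in>Basis. (v \<bullet> b) * l b)"
    by (simp add: linear_sum[OF assms] linear_scale[OF assms])
  finally show ?thesis by (simp add: endo_trace_def mult.commute)
qed

text \<open>
  A constant covector \<open>p\<close> with constant metric dual \<open>N\<close> along which the metric does not change. Then
  \<open>N\<close> is parallel, and so is \<open>p\<close>. The coordinate \<open>\<xi>\<close> on a product of a flat space with \<open>F\<close> is the
  motivating case; a conformal factor that is a function of \<open>p\<close> then changes the curvature by
  an explicit expression in \<open>p\<close> and \<open>g\<close>.
\<close>

locale parallel_covector = chart_metric S g for S :: "'e::euclidean_space set" and g +
  fixes p :: "'e \<Rightarrow> real" and N :: 'e
  assumes linear_p: "linear p"
    and metric_N: "x \<in> S \<Longrightarrow> g x N v = p v"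
    and killing_N: "x \<in> S \<Longrightarrow> dird (\<lambda>y. g y v w) x N = 0"
begin

lemmas p_simps = linear_add[OF linear_p] linear_diff[OF linear_p] linear_scale[OF linear_p]
  linear_neg[OF linear_p] linear_0[OF linear_p]

lemma metric_N': "x \<in> S \<Longrightarrow> g x v N = p v"
  using metric_N[of x v] metric_sym[of x v N] by simp

lemma dg_N:
  assumes "x \<in> S"
  shows "dg x u v N = 0" "dg x u N v = 0"
proof -
  have "dg x u v N = dird (\<lambda>y. p v) x u"
    using dird_cong[OF open_dom assms, of "\<lambda>y. g y v N" "\<lambda>y. p v"] metric_N' by simp
  then show "dg x u v N = 0" by simp
  then show "dg x u N v = 0" using dg_sym[OF assms, of v N u] by simp
qed

lemma p_christoffel: "x \<in> S \<Longrightarrow> p (\<Gamma> x v w) = 0"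
  using metric_christoffel[of x v w N] by (simp add: metric_N' koszul_def dg_N killing_N)

lemma christoffel_N: "x \<in> S \<Longrightarrow> \<Gamma> x v N = 0"
  by (rule christoffel_unique) (simp_all add: metric_linear_simps koszul_def dg_N killing_N)

definition conf where "conf \<phi> x v w = g x v w / (\<phi> (p x))\<^sup>2"

text \<open>
  The tensor by which the connections of \<open>g\<close> and of the conformal metric differ, up to the
  factor \<open>s = - \<phi>' / \<phi>\<close>, the derivative of \<open>- ln \<phi>\<close>.
\<close>

definition difference_tensor where "difference_tensor x v w = p v *\<^sub>R w + p w *\<^sub>R v - g x v w *\<^sub>R N"

lemma has_derivative_along_p:
  assumes "(F has_real_derivative D) (at (p x))"
  shows "((\<lambda>y. F (p y)) has_derivative (\<lambda>u. D * p u)) (at x)"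
proof -
  have "(p has_derivative p) (at x)"
    using linear_p by (simp add: linear_imp_has_derivative)
  from diff_chain_at[OF this assms[unfolded has_field_derivative_def]]
  show ?thesis by (simp add: comp_def)
qed

context
  fixes \<phi> \<phi>' :: "real \<Rightarrow> real"
  assumes \<phi>: "\<And>x. x \<in> S \<Longrightarrow> (\<phi> has_real_derivative \<phi>' (p x)) (at (p x))"
    and \<phi>_nz: "\<And>x. x \<in> S \<Longrightarrow> \<phi> (p x) \<noteq> 0"
begin

private abbreviation s where "s t \<equiv> - \<phi>' t / \<phi> t"

lemma sharp_conf:
  assumes "x \<in> S"
  shows "sharp (conf \<phi>) x l = sharp g x (\<lambda>w. (\<phi> (p x))\<^sup>2 * l w)"
  unfolding sharp_def conf_def using \<phi>_nz[OF assms] by (simp add: divide_eq_eq mult.commute)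

lemma dird_conf:
  assumes "x \<in> S"
  shows "dird (\<lambda>y. conf \<phi> y v w) x u = (dg x u v w + 2 * s (p x) * p u * g x v w) / (\<phi> (p x))\<^sup>2"
proof -
  have "((\<lambda>t. inverse ((\<phi> t)\<^sup>2)) has_real_derivative 2 * s (p x) / (\<phi> (p x))\<^sup>2) (at (p x))"
    using \<phi>_nz[OF assms]
    by (auto intro!: derivative_eq_intros \<phi>[OF assms] simp: field_simps power2_eq_square)
  from has_derivative_mult[OF dg_has_derivative[OF assms, of v w] has_derivative_along_p[OF this]]
  have "((\<lambda>y. conf \<phi> y v w) has_derivative (\<lambda>u. g x v w * (2 * s (p x) / (\<phi> (p x))\<^sup>2 * p u) +
      dg x u v w * inverse ((\<phi> (p x))\<^sup>2))) (at x)"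
    by (simp add: conf_def divide_inverse)
  from dirdI[OF this, of u] show ?thesis by (simp add: divide_inverse algebra_simps)
qed

lemma christoffel_conf:
  assumes x: "x \<in> S"
  shows "christoffel (conf \<phi>) x v w = \<Gamma> x v w + s (p x) *\<^sub>R difference_tensor x v w"
  unfolding christoffel_def[of "conf \<phi>"] sharp_conf[OF x]
  by (rule sharp_unique[OF x])
    (use \<phi>_nz[OF x] in \<open>simp add: metric_linear_simps[OF x] metric_christoffel[OF x] koszul_def
      difference_tensor_def metric_N[OF x] dird_conf[OF x] metric_sym[OF x, of w v] field_simps\<close>)

lemma dird_christoffel_conf:
  assumes x: "x \<in> S" and s': "(s has_real_derivative s') (at (p x))"
  shows "dird (\<lambda>y. christoffel (conf \<phi>) y v w) x u =
    dird (\<lambda>y. \<Gamma> y v w) x u + (s' * p u) *\<^sub>R difference_tensor x v w - (s (p x) * dg x u v w) *\<^sub>R N"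
proof -
  have "((\<lambda>y. difference_tensor y v w) has_derivative (\<lambda>u. 0 - dg x u v w *\<^sub>R N)) (at x)"
    unfolding difference_tensor_def
    by (intro has_derivative_diff has_derivative_const has_derivative_scaleR_left
        dg_has_derivative[OF x])
  from has_derivative_add[OF has_derivative_dird[OF christoffel_differentiable[OF x]]
      has_derivative_scaleR[OF has_derivative_along_p[OF s'] this]]
  have "((\<lambda>y. christoffel (conf \<phi>) y v w) has_derivative
      (\<lambda>u. dird (\<lambda>y. \<Gamma> y v w) x u +
        (s (p x) *\<^sub>R (0 - dg x u v w *\<^sub>R N) + (s' * p u) *\<^sub>R difference_tensor x v w))) (at x)"
    by (rule has_derivative_transform_within_open[OF _ open_dom x]) (simp add: christoffel_conf)
  from dirdI[OF this, of u] show ?thesis by (simp add: algebra_simps)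
qed

text \<open>
  Both sides are compared by pairing with an arbitrary vector \<open>z\<close>, which turns the identity into
  one between real polynomials. All terms that contain Christoffel symbols of \<open>g\<close> beside its
  curvature cancel, because \<open>p\<close> and \<open>N\<close> are parallel and the connection is torsion-free and
  compatible with \<open>g\<close>.
\<close>

lemma riemann_conf:
  assumes x: "x \<in> S" and s': "(s has_real_derivative s') (at (p x))"
  shows "riemann (conf \<phi>) x u v w = riemann g x u v w
    + (s' - (s (p x))\<^sup>2) *\<^sub>R (p u *\<^sub>R (p w *\<^sub>R v) - (p v * p w) *\<^sub>R u
         - p u *\<^sub>R (g x v w *\<^sub>R N) + g x u w *\<^sub>R (p v *\<^sub>R N))
    + ((s (p x))\<^sup>2 * p N) *\<^sub>R (g x u w *\<^sub>R v - g x v w *\<^sub>R u)"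
    (is "?L = ?R")
proof (rule metric_eqI[OF x])
  fix z
  note lin = linear_add[OF christoffel_linear[OF x]] linear_diff[OF christoffel_linear[OF x]]
    linear_scale[OF christoffel_linear[OF x]]
  show "g x ?L z = g x ?R z"
    unfolding riemann_def dird_christoffel_conf[OF x s'] christoffel_conf[OF x]
    unfolding difference_tensor_def metric_compatible[OF x]
    by (simp add: lin p_simps metric_linear_simps[OF x] christoffel_N[OF x] p_christoffel[OF x]
        christoffel_sym[OF x, of v u] metric_sym[OF x, of v u] metric_N[OF x] metric_N'[OF x]
        power2_eq_square algebra_simps)
qed

lemma linear_metric: "x \<in> S \<Longrightarrow> linear (\<lambda>u. g x u w)"
  using bilinear_metric unfolding bilinear_def by blast

lemma ricci_conf:
  assumes x: "x \<in> S" and s': "(s has_real_derivative s') (at (p x))"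
  shows "ricci (conf \<phi>) x v w = ricci g x v w
    + (real DIM('e) - 2) * ((s (p x))\<^sup>2 - s') * p v * p w
    - p N * (s' + (real DIM('e) - 2) * (s (p x))\<^sup>2) * g x v w"
proof -
  show ?thesis
  unfolding ricci_def riemann_conf[OF x s']
  unfolding endo_trace_add endo_trace_diff endo_trace_scale endo_trace_ident
    endo_trace_rank_one[OF linear_p] endo_trace_rank_one[OF linear_metric[OF x]]
  by (simp add: p_simps metric_linear_simps[OF x] metric_N[OF x] metric_N'[OF x]
    metric_sym[OF x, of w v] algebra_simps)
qed

lemma scalar_curvature_conf:
  assumes x: "x \<in> S" and s': "(s has_real_derivative s') (at (p x))"
  shows "scalar_curvature (conf \<phi>) x = (\<phi> (p x))\<^sup>2 * (scalar_curvature g x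
    - p N * (real DIM('e) - 1) * (2 * s' + (real DIM('e) - 2) * (s (p x))\<^sup>2))"
proof -
  let ?m = "real DIM('e)"
  have "sharp (conf \<phi>) x (ricci (conf \<phi>) x v) = (\<phi> (p x))\<^sup>2 *\<^sub>R (sharp g x (ricci g x v)
      + ((?m - 2) * ((s (p x))\<^sup>2 - s')) *\<^sub>R (p v *\<^sub>R N)
      - (p N * (s' + (?m - 2) * (s (p x))\<^sup>2)) *\<^sub>R v)" for v
    unfolding sharp_conf[OF x] ricci_conf[OF x s']
    by (rule sharp_unique[OF x])
      (simp add: metric_linear_simps[OF x] metric_sharp[OF x ricci_linear[OF x]] metric_N[OF x]
        algebra_simps)
  then have "scalar_curvature (conf \<phi>) x = endo_trace (\<lambda>v. (\<phi> (p x))\<^sup>2 *\<^sub>R (sharp g x (ricci g x v)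
      + ((?m - 2) * ((s (p x))\<^sup>2 - s')) *\<^sub>R (p v *\<^sub>R N)
      - (p N * (s' + (?m - 2) * (s (p x))\<^sup>2)) *\<^sub>R v))"
    by (simp only: scalar_curvature_def)
  then show ?thesis
    unfolding endo_trace_add endo_trace_diff endo_trace_scale endo_trace_ident
      endo_trace_rank_one[OF linear_p]
    by (simp add: scalar_curvature_def algebra_simps)
qed

end
end

section \<open>Scalar curvature of the product with a flat space\<close>

text \<open>
  Curvature is local. The warping function is only controlled on the interval of definition, so
  two metrics have to be compared on an open set.
\<close>

lemma scalar_curvature_cong:
  assumes "open S" "x \<in> S" "\<And>y. y \<in> S \<Longrightarrow> g y = g' y"
  shows "scalar_curvature g x = scalar_curvature g' x"
proof -
  have c: "christoffel g y v w = christoffel g' y v w" if "y \<in> S" for y v w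
  proof -
    have "dird (\<lambda>y. g y a b) y = dird (\<lambda>y. g' y a b) y" for a b
      using assms by (intro dird_cong[OF assms(1) that]) simp
    then show ?thesis by (simp add: christoffel_def sharp_def assms(3)[OF that])
  qed
  have "dird (\<lambda>y. christoffel g y v w) x = dird (\<lambda>y. christoffel g' y v w) x" for v w
    using c by (intro dird_cong[OF assms(1,2)])
  then show ?thesis
    by (simp add: scalar_curvature_def ricci_def[abs_def] riemann_def c assms sharp_def)
qed

lemma endo_trace_snd:
  "endo_trace (\<lambda>u :: 'b::euclidean_space \<times> 'e::euclidean_space. (0, A (snd u))) = endo_trace A"
proof -
  have "inj_on (\<lambda>u. (u, 0 :: 'e)) (Basis :: 'b set)" "inj_on (Pair (0 :: 'b)) (Basis :: 'e set)"
    by (auto intro!: inj_onI)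
  then show ?thesis
    unfolding endo_trace_def Basis_prod_def
    by (subst sum.union_disjoint) (auto simp: sum.reindex)
qed

text \<open>
  The metric \<open>B + k\<^sup>2 g\<^sub>F\<close> is treated as a warped product with constant data, so that it is a metric in
  the sense of \<^locale>\<open>chart_metric\<close> by the general result on warped products.
\<close>

locale flat_product =
  fixes \<Omega> :: "'b::euclidean_space set" and B :: "'b \<Rightarrow> 'b \<Rightarrow> real" and k :: real
    and F :: "('p, 'i, 'e::euclidean_space) semi_riemannian" and i :: 'i
  assumes F: "semi_riemannian_manifold F" and i: "i \<in> charts F"
    and \<Omega>: "open \<Omega>"
    and B: "bilinear B" "\<And>v w. B v w = B w v" "\<And>v. \<forall>w. B v w = 0 \<Longrightarrow> v = 0"
    and k: "k \<noteq> 0"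
begin

abbreviation P where "P \<equiv> metric (warped_product \<Omega> (\<lambda>_. B) (\<lambda>_. k) F) i"
abbreviation U where "U \<equiv> chart_image F i"

sublocale F: chart_metric U "metric F i"
  using semi_riemannian_chart_metric[OF F i] .

lemma P_eq: "P z V W = B (fst V) (fst W) + k\<^sup>2 * metric F i (snd z) (snd V) (snd W)"
  by (simp add: warped_product_metric)

lemma product_chart_metric: "chart_metric (\<Omega> \<times> U) P"
proof (cases "\<Omega> = {}")
  case False
  have "semi_riemannian_manifold (warped_product \<Omega> (\<lambda>_. B) (\<lambda>_. k) F)"
    using k by (intro semi_riemannian_manifold_warped_product[OF F \<Omega> False] B)
      (simp_all add: smooth_on_def Ck_on_const)
  from semi_riemannian_chart_metric[OF this, of i] show ?thesis
    using i by (simp add: warped_product_simps(2) warped_product_chart_image)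
qed (unfold_locales, auto)

sublocale P: chart_metric "\<Omega> \<times> U" P
  by (rule product_chart_metric)

lemma P_has_derivative:
  assumes "z \<in> \<Omega> \<times> U"
  shows "((\<lambda>z. P z V W) has_derivative (\<lambda>u. k\<^sup>2 * F.dg (snd z) (snd u) (snd V) (snd W))) (at z)"
proof -
  have "snd z \<in> U" using assms by auto
  from diff_chain_at[OF bounded_linear_imp_has_derivative[OF bounded_linear_snd]
      F.dg_has_derivative[OF this]]
  have "((\<lambda>z. metric F i (snd z) (snd V) (snd W)) has_derivative
      (\<lambda>u. F.dg (snd z) (snd u) (snd V) (snd W))) (at z)"
    by (simp add: comp_def)
  then have "((\<lambda>z. B (fst V) (fst W) + k\<^sup>2 * metric F i (snd z) (snd V) (snd W)) has_derivative
      (\<lambda>u. 0 + k\<^sup>2 * F.dg (snd z) (snd u) (snd V) (snd W))) (at z)"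
    by (intro has_derivative_add has_derivative_const has_derivative_mult_right)
  then show ?thesis by (simp add: P_eq)
qed

lemmas dird_P = dirdI[OF P_has_derivative]

lemma christoffel_P:
  assumes "z \<in> \<Omega> \<times> U"
  shows "christoffel P z V W = (0, christoffel (metric F i) (snd z) (snd V) (snd W))"
proof (rule P.christoffel_unique[OF assms])
  have "snd z \<in> U" using assms by auto
  then show "P z (0, christoffel (metric F i) (snd z) (snd V) (snd W)) Z = P.koszul z V W Z" for Z
    unfolding P.koszul_def dird_P[OF assms]
    by (simp add: P_eq F.metric_christoffel F.koszul_def
        bilinear_lzero[OF B(1)] algebra_simps)
qed

lemma riemann_P:
  assumes "z \<in> \<Omega> \<times> U"
  shows "riemann P z X V W = (0, riemann (metric F i) (snd z) (snd X) (snd V) (snd W))"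
proof -
  have y: "snd z \<in> U" using assms by auto
  have "dird (\<lambda>z. christoffel P z V W) z X =
      (0, dird (\<lambda>y. christoffel (metric F i) y (snd V) (snd W)) (snd z) (snd X))" for X V W
  proof -
    from diff_chain_at[OF bounded_linear_imp_has_derivative[OF bounded_linear_snd]
        has_derivative_dird[OF F.christoffel_differentiable[OF y]]]
    have "((\<lambda>z. christoffel (metric F i) (snd z) (snd V) (snd W)) has_derivative
        (\<lambda>X. dird (\<lambda>y. christoffel (metric F i) y (snd V) (snd W)) (snd z) (snd X))) (at z)"
      by (simp add: comp_def)
    from has_derivative_Pair[OF has_derivative_const this]
    have "((\<lambda>z. christoffel P z V W) has_derivative
        (\<lambda>X. (0, dird (\<lambda>y. christoffel (metric F i) y (snd V) (snd W)) (snd z) (snd X)))) (at z)"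
      by (rule has_derivative_transform_within_open[OF _ P.open_dom assms]) (simp add: christoffel_P)
    then show ?thesis by (rule dirdI)
  qed
  then show ?thesis by (simp add: riemann_def christoffel_P[OF assms])
qed

text \<open>
  Neither the flat factor nor a constant rescaling contributes to the Ricci tensor, while raising
  an index of \<open>k\<^sup>2 g\<^sub>F\<close> produces the factor \<open>1 / k\<^sup>2\<close>.
\<close>

lemma scalar_curvature_P:
  assumes "z \<in> \<Omega> \<times> U"
  shows "scalar_curvature P z = scalar_curvature (metric F i) (snd z) / k\<^sup>2"
proof -
  have y: "snd z \<in> U" using assms by auto
  have ric: "ricci P z V W = ricci (metric F i) (snd z) (snd V) (snd W)" for V W
    unfolding ricci_def riemann_P[OF assms] by (rule endo_trace_snd)
  let ?R = "\<lambda>w. (1 / k\<^sup>2) *\<^sub>R sharp (metric F i) (snd z) (ricci (metric F i) (snd z) w)"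
  have "sharp P z (ricci P z V) = (0, ?R (snd V))" for V
    by (rule P.sharp_unique[OF assms])
      (use k in \<open>simp add: ric P_eq bilinear_lzero[OF B(1)] F.metric_linear_simps[OF y]
        F.metric_sharp[OF y F.ricci_linear[OF y]]\<close>)
  then have "scalar_curvature P z = endo_trace (\<lambda>V :: 'b \<times> 'e. (0, ?R (snd V)))"
    by (simp only: scalar_curvature_def)
  also have "\<dots> = endo_trace ?R" by (rule endo_trace_snd)
  finally show ?thesis by (simp add: endo_trace_scale scalar_curvature_def)
qed

end

section \<open>The Hessian of the potential\<close>

text \<open>
  The geometric data, with the flat metric replaced by any nondegenerate symmetric bilinear form
  \<open>B\<close>. The vector \<open>N\<close> is the gradient of \<open>\<xi>\<close> with respect to \<open>B\<close>, so \<open>\<xi> N\<close> is the squared norm of the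
  covector \<open>\<xi>\<close>.
\<close>

locale conformally_flat_warped_product =
  fixes F :: "('p, 'i, 'e::euclidean_space) semi_riemannian"
    and B :: "'b::euclidean_space \<Rightarrow> 'b \<Rightarrow> real" and \<xi> :: "'b \<Rightarrow> real" and N :: 'b
    and I :: "real set" and \<phi> f :: "real \<Rightarrow> real"
  assumes F: "semi_riemannian_manifold F"
    and B: "bilinear B" "\<And>v w. B v w = B w v" "\<And>v. \<forall>w. B v w = 0 \<Longrightarrow> v = 0"
    and linear_\<xi>: "linear \<xi>" and N: "\<And>v. B N v = \<xi> v" and \<xi>_N: "\<xi> N \<noteq> 0"
    and I: "open I" "I \<noteq> {}"
    and smooth_\<phi>: "smooth_on I \<phi>" and smooth_f: "smooth_on I f"
    and \<phi>_pos: "\<And>t. t \<in> I \<Longrightarrow> \<phi> t > 0" and f_pos: "\<And>t. t \<in> I \<Longrightarrow> f t > 0"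
begin

abbreviation \<Omega> where "\<Omega> \<equiv> \<xi> -` I"
abbreviation M where
  "M \<equiv> warped_product \<Omega> (\<lambda>x v w. B v w / (\<phi> (\<xi> x))\<^sup>2) (\<lambda>x. f (\<xi> x)) F"

lemma bounded_linear_\<xi>: "bounded_linear \<xi>"
  using linear_\<xi> by (simp add: linear_conv_bounded_linear)

lemma open_\<Omega>: "open \<Omega>"
  using I(1) bounded_linear_\<xi> by (simp add: continuous_open_vimage linear_continuous_at)

lemma \<xi>_surj:
  obtains x where "\<xi> x = t"
proof
  show "\<xi> ((t / \<xi> N) *\<^sub>R N) = t" using \<xi>_N by (simp add: linear_scale[OF linear_\<xi>])
qed

lemma \<Omega>_nonempty: "\<Omega> \<noteq> {}"
proof -
  obtain t where "t \<in> I" using I by blast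
  moreover obtain x where "\<xi> x = t" by (rule \<xi>_surj)
  ultimately have "x \<in> \<Omega>" by simp
  then show ?thesis by blast
qed

lemma smooth_on_along_\<xi>:
  assumes "smooth_on I \<psi>"
  shows "smooth_on \<Omega> (\<lambda>x. \<psi> (\<xi> x))"
  using assms unfolding smooth_on_def
  by (intro allI Ck_on_compose_linear[OF bounded_linear_\<xi> open_\<Omega>]) auto

lemma M_semi_riemannian: "semi_riemannian_manifold M"
proof (rule semi_riemannian_manifold_warped_product[OF F open_\<Omega> \<Omega>_nonempty])
  show "bilinear (\<lambda>v w. B v w / (\<phi> (\<xi> x))\<^sup>2)" for x
    unfolding bilinear_def linear_iff
    by (simp add: bilinear_ladd[OF B(1)] bilinear_radd[OF B(1)] bilinear_lmul[OF B(1)]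
        bilinear_rmul[OF B(1)] add_divide_distrib)
  show "B v w / (\<phi> (\<xi> x))\<^sup>2 = B w v / (\<phi> (\<xi> x))\<^sup>2" for x v w using B(2) by simp
  show "v = 0" if "x \<in> \<Omega>" "\<forall>w. B v w / (\<phi> (\<xi> x))\<^sup>2 = 0" for x v
    using that B(3)[of v] \<phi>_pos[of "\<xi> x"] by auto
  show "smooth_on \<Omega> (\<lambda>x. B v w / (\<phi> (\<xi> x))\<^sup>2)" for v w
    unfolding smooth_on_def
  proof
    fix k
    have "Ck_on k \<Omega> (\<lambda>x. \<phi> (\<xi> x))"
      using smooth_on_along_\<xi>[OF smooth_\<phi>] unfolding smooth_on_def by blast
    moreover have "\<phi> (\<xi> x) \<noteq> 0" if "x \<in> \<Omega>" for x using \<phi>_pos[of "\<xi> x"] that by simp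
    ultimately have "Ck_on k \<Omega> (\<lambda>x. inverse (\<phi> (\<xi> x)))"
      by (intro Ck_on_inverse[OF open_\<Omega>])
    then have "Ck_on k \<Omega> (\<lambda>x. B v w * (inverse (\<phi> (\<xi> x)) * inverse (\<phi> (\<xi> x))))"
      by (intro Ck_on_mult[OF open_\<Omega>] Ck_on_const)
    then show "Ck_on k \<Omega> (\<lambda>x. B v w / (\<phi> (\<xi> x))\<^sup>2)"
      by (simp add: divide_inverse power2_eq_square)
  qed
  show "smooth_on \<Omega> (\<lambda>x. f (\<xi> x))" by (rule smooth_on_along_\<xi>[OF smooth_f])
  show "f (\<xi> x) \<noteq> 0" if "x \<in> \<Omega>" for x using that f_pos[of "\<xi> x"] by simp
qed

lemma potential_in_chart:
  assumes "i \<in> charts F" "z \<in> \<Omega> \<times> chart_image F i"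
  shows "((\<lambda>z. h (\<xi> (fst z))) \<circ> param M i) z = h (\<xi> (fst z))"
proof -
  have "smooth_manifold F" using F unfolding semi_riemannian_manifold_def by blast
  from warped_product_param[OF this assms(1), of "fst z" _ "snd z"] show ?thesis
    using assms(2) by (auto simp: comp_def)
qed

lemma has_derivative_along_\<xi>:
  assumes "(\<psi> has_real_derivative D) (at (\<xi> (fst z)))"
  shows "((\<lambda>y :: 'b \<times> 'e. \<psi> (\<xi> (fst y))) has_derivative (\<lambda>V. D * \<xi> (fst V))) (at z)"
proof -
  have "((\<lambda>y :: 'b \<times> 'e. \<xi> (fst y)) has_derivative (\<lambda>V. \<xi> (fst V))) (at z)"
    by (intro bounded_linear_imp_has_derivative bounded_linear_compose[OF bounded_linear_\<xi>]
        bounded_linear_fst)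
  from diff_chain_at[OF this assms[unfolded has_field_derivative_def]]
  show ?thesis by (simp add: comp_def)
qed

context
  fixes i
  assumes i: "i \<in> charts F"
begin

interpretation F: chart_metric "chart_image F i" "metric F i"
  using semi_riemannian_chart_metric[OF F i] .

interpretation M: chart_metric "\<Omega> \<times> chart_image F i" "metric M i"
  using semi_riemannian_chart_metric[OF M_semi_riemannian, of i] i
  by (simp add: warped_product_simps(2) warped_product_chart_image)

context
  fixes z t assumes z: "z \<in> \<Omega> \<times> chart_image F i" and t: "t = \<xi> (fst z)"
begin

private lemma t_in_I: "t \<in> I" using z t by auto

lemma dird_warped_metric:
  "dird (\<lambda>z. metric M i z V W) z X =
     - 2 * deriv \<phi> t / (\<phi> t)^3 * \<xi> (fst X) * B (fst V) (fst W)
     + 2 * f t * deriv f t * \<xi> (fst X) * metric F i (snd z) (snd V) (snd W)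
     + (f t)\<^sup>2 * F.dg (snd z) (snd X) (snd V) (snd W)"
proof -
  have nz: "\<phi> t \<noteq> 0" using \<phi>_pos[OF t_in_I] by simp
  have y: "snd z \<in> chart_image F i" using z by auto
  have "((\<lambda>t. inverse ((\<phi> t)\<^sup>2)) has_real_derivative - 2 * deriv \<phi> t / (\<phi> t)^3) (at t)"
    using nz by (auto intro!: derivative_eq_intros smooth_on_has_deriv[OF smooth_\<phi> t_in_I]
        simp: field_simps power2_eq_square power3_eq_cube)
  then have 1: "((\<lambda>y :: 'b \<times> 'e. inverse ((\<phi> (\<xi> (fst y)))\<^sup>2)) has_derivative
      (\<lambda>X. - 2 * deriv \<phi> t / (\<phi> t)^3 * \<xi> (fst X))) (at z)"
    unfolding t by (rule has_derivative_along_\<xi>)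
  have "((\<lambda>t. (f t)\<^sup>2) has_real_derivative 2 * f t * deriv f t) (at t)"
    by (auto intro!: derivative_eq_intros smooth_on_has_deriv[OF smooth_f t_in_I])
  then have 2: "((\<lambda>y :: 'b \<times> 'e. (f (\<xi> (fst y)))\<^sup>2) has_derivative
      (\<lambda>X. 2 * f t * deriv f t * \<xi> (fst X))) (at z)"
    unfolding t by (rule has_derivative_along_\<xi>)
  from diff_chain_at[OF bounded_linear_imp_has_derivative[OF bounded_linear_snd]
      F.dg_has_derivative[OF y]]
  have 3: "((\<lambda>z. metric F i (snd z) (snd V) (snd W)) has_derivative
      (\<lambda>X. F.dg (snd z) (snd X) (snd V) (snd W))) (at z)"
    by (simp add: comp_def)
  have "((\<lambda>z. metric M i z V W) has_derivative
    (\<lambda>X. B (fst V) (fst W) * (- 2 * deriv \<phi> t / (\<phi> t)^3 * \<xi> (fst X)) +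
      ((f (\<xi> (fst z)))\<^sup>2 * F.dg (snd z) (snd X) (snd V) (snd W) +
       2 * f t * deriv f t * \<xi> (fst X) * metric F i (snd z) (snd V) (snd W)))) (at z)"
    using has_derivative_add[OF has_derivative_mult_right[OF 1] has_derivative_mult[OF 2 3]]
    by (simp add: warped_product_metric divide_inverse)
  from dirdI[OF this, of X] show ?thesis unfolding t by (simp add: algebra_simps)
qed

text \<open>
  The only component of the connection that the Hessian of a function of \<open>\<xi>\<close> involves. Since
  \<open>\<phi>\<^sup>2 N\<close> is the gradient of \<open>\<xi>\<close>, it equals the Koszul expression paired with that vector.
\<close>

lemma \<xi>_christoffel:
  "\<xi> (fst (christoffel (metric M i) z V W)) =
     - 2 * deriv \<phi> t / \<phi> t * \<xi> (fst V) * \<xi> (fst W) + deriv \<phi> t / \<phi> t * \<xi> N * B (fst V) (fst W)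
     - (\<phi> t)\<^sup>2 * f t * deriv f t * \<xi> N * metric F i (snd z) (snd V) (snd W)"
proof -
  have nz: "\<phi> t \<noteq> 0" using \<phi>_pos[OF t_in_I] by simp
  have y: "snd z \<in> chart_image F i" using z by auto
  have BN: "B v N = \<xi> v" for v using N B(2) by metis
  have dg0: "F.dg (snd z) 0 v w = 0" for v w
    using F.dg_linear(2)[OF y, where c = 0 and u = 0] by simp
  have dg0': "F.dg (snd z) v w 0 = 0" for v w
    using F.dg_linear(6)[OF y, where c = 0 and w = 0] by simp
  let ?\<Gamma> = "christoffel (metric M i) z V W"
  have "\<xi> (fst ?\<Gamma>) = (\<phi> t)\<^sup>2 * metric M i z ?\<Gamma> (N, 0)"
    using nz by (simp add: warped_product_metric BN F.metric_linear_simps[OF y] t)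
  also have "\<dots> = (\<phi> t)\<^sup>2 * M.koszul z V W (N, 0)"
    by (simp add: M.metric_christoffel[OF z])
  also have "\<dots> = - 2 * deriv \<phi> t / \<phi> t * \<xi> (fst V) * \<xi> (fst W)
     + deriv \<phi> t / \<phi> t * \<xi> N * B (fst V) (fst W)
     - (\<phi> t)\<^sup>2 * f t * deriv f t * \<xi> N * metric F i (snd z) (snd V) (snd W)"
    unfolding M.koszul_def dird_warped_metric using nz
    by (simp add: BN dg0 dg0' F.metric_linear_simps[OF y]
        field_simps power2_eq_square power3_eq_cube)
  finally show ?thesis .
qed

lemma hessian_potential:
  assumes h: "smooth_on I h"
  shows "hessian (metric M i) ((\<lambda>z. h (\<xi> (fst z))) \<circ> param M i) z V W =
     (deriv (deriv h) t + 2 * deriv h t * deriv \<phi> t / \<phi> t) * \<xi> (fst V) * \<xi> (fst W)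
     - deriv h t * deriv \<phi> t / \<phi> t * \<xi> N * B (fst V) (fst W)
     + deriv h t * (\<phi> t)\<^sup>2 * f t * deriv f t * \<xi> N * metric F i (snd z) (snd V) (snd W)"
proof -
  let ?u = "(\<lambda>z. h (\<xi> (fst z))) \<circ> param M i"
  have du: "dird ?u y W = deriv h (\<xi> (fst y)) * \<xi> (fst W)"
    if y: "y \<in> \<Omega> \<times> chart_image F i" for y W
  proof -
    have "dird ?u y = dird (\<lambda>z. h (\<xi> (fst z))) y"
      by (rule dird_cong[OF M.open_dom y]) (rule potential_in_chart[OF i])
    moreover have "\<xi> (fst y) \<in> I" using y by auto
    ultimately show ?thesis
      using dirdI[OF has_derivative_along_\<xi>[OF smooth_on_has_deriv[OF h]], of y W] by simp
  qed
  have "((\<lambda>y. dird ?u y W) has_derivative (\<lambda>X. deriv (deriv h) t * \<xi> (fst X) * \<xi> (fst W))) (at z)"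
  proof (rule has_derivative_transform_within_open[OF _ M.open_dom z])
    have "(deriv h has_real_derivative deriv (deriv h) t) (at (\<xi> (fst z)))"
      using smooth_on_has_deriv[OF smooth_on_deriv[OF I(1) h] t_in_I] by (simp add: t)
    then show "((\<lambda>y :: 'b \<times> 'e. deriv h (\<xi> (fst y)) * \<xi> (fst W)) has_derivative
        (\<lambda>X. deriv (deriv h) t * \<xi> (fst X) * \<xi> (fst W))) (at z)"
      by (intro has_derivative_mult_left has_derivative_along_\<xi>)
  qed (simp add: du)
  then have "dird (\<lambda>y. dird ?u y W) z V = deriv (deriv h) t * \<xi> (fst V) * \<xi> (fst W)"
    by (rule dirdI)
  then show ?thesis
    unfolding hessian_def du[OF z] \<xi>_christoffel t[symmetric] by (simp add: algebra_simps)
qed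

end
end

end

section \<open>From the soliton equation to ordinary differential equations\<close>

lemma const_imp_deriv_0:
  fixes F :: "real \<Rightarrow> real"
  assumes "(F has_real_derivative D) (at t)" "open I" "t \<in> I" "\<And>x. x \<in> I \<Longrightarrow> F x = c"
  shows "D = 0"
proof -
  have "((\<lambda>_. c) has_real_derivative D) (at t)"
    using assms(1) assms(4) has_field_derivative_transform_within_open[OF assms(1-3)] by simp
  then show ?thesis using DERIV_const DERIV_unique by blast
qed

lemma deriv_0_imp_const:
  fixes F :: "real \<Rightarrow> real"
  assumes "convex I" "\<And>x. x \<in> I \<Longrightarrow> (F has_real_derivative 0) (at x)"
  obtains c where "\<And>x. x \<in> I \<Longrightarrow> F x = c"
  using has_field_derivative_zero_constant[OF assms(1), of F] assms(2)
    has_field_derivative_at_within by blast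

lemma exists_kernel_vector:
  fixes l :: "'b::euclidean_space \<Rightarrow> real"
  assumes "linear l" "DIM('b) \<ge> 2"
  obtains v where "v \<noteq> 0" "l v = 0"
proof -
  have "\<not> inj l"
  proof
    assume "inj l"
    then have "dim (range l) = DIM('b)" using dim_image_eq[OF assms(1), of UNIV] by simp
    moreover have "dim (range l) \<le> DIM(real)" by (rule dim_subset_UNIV)
    ultimately show False using assms(2) by simp
  qed
  then show ?thesis using that linear_injective_0[OF assms(1)] by blast
qed

text \<open>
  The tensors \<open>\<xi> \<otimes> \<xi>\<close>, \<open>B\<close> and \<open>g\<^sub>F\<close> are linearly independent. A base vector in the kernel of \<open>\<xi>\<close>
  isolates the coefficient of \<open>B\<close>, which is where two base dimensions enter; then \<open>N\<close> isolates that
  of \<open>\<xi> \<otimes> \<xi>\<close>, and a fibre vector that of \<open>g\<^sub>F\<close>.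
\<close>

lemma (in conformally_flat_warped_product) soliton_equation_coefficients:
  assumes dim: "DIM('b) \<ge> 2" and i: "i \<in> charts F" and y: "y \<in> chart_image F i"
  shows "(\<forall>V W. S * (B (fst V) (fst W) + r * metric F i y (snd V) (snd W)) =
            a * \<xi> (fst V) * \<xi> (fst W) + b * B (fst V) (fst W) + c * metric F i y (snd V) (snd W))
         \<longleftrightarrow> a = 0 \<and> S = b \<and> S * r = c"
  (is "?L \<longleftrightarrow> ?R")
proof
  interpret F: chart_metric "chart_image F i" "metric F i"
    using semi_riemannian_chart_metric[OF F i] .
  assume L: ?L
  have base: "S * B v w = a * \<xi> v * \<xi> w + b * B v w" for v w
    using L[rule_format, of "(v, 0)" "(w, 0)"] by (simp add: F.metric_linear_simps[OF y])
  have fibre: "S * r * metric F i y v w = c * metric F i y v w" for v w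
    using L[rule_format, of "(0, v)" "(0, w)"]
    by (simp add: bilinear_lzero[OF B(1)] linear_0[OF linear_\<xi>] algebra_simps)
  obtain v where "v \<noteq> 0" "\<xi> v = 0" using exists_kernel_vector[OF linear_\<xi> dim] .
  moreover from this obtain w where "B v w \<noteq> 0" using B(3) by blast
  ultimately have Sb: "S = b" using base[of v w] by simp
  then have "a * \<xi> N * \<xi> N = 0" using base[of N N] by simp
  then have "a = 0" using \<xi>_N by simp
  moreover have "S * r = c"
  proof -
    obtain v :: 'e where "v \<noteq> 0" using nonzero_Basis nonempty_Basis by blast
    then obtain w where "metric F i y v w \<noteq> 0" using F.nondegenerate[OF y] by blast
    then show ?thesis using fibre[of v w] by simp
  qed
  ultimately show ?R using Sb by simp
next
  assume ?R
  then show ?L by (auto simp: algebra_simps)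
qed

context conformally_flat_warped_product
begin

text \<open>
  The three coefficients of the soliton equation, with the scalar curvature still unevaluated. Where
  \<open>h'\<close> does not vanish, the last two together imply that \<open>(f \<phi>)' = 0\<close>.
\<close>

lemma steady_iff_scalar_curvature:
  assumes h: "smooth_on I h" and dim: "DIM('b) \<ge> 2"
  shows "steady_gradient_yamabe_soliton M (\<lambda>z. h (\<xi> (fst z))) \<longleftrightarrow>
    (\<forall>i\<in>charts F. \<forall>z \<in> \<Omega> \<times> chart_image F i. \<forall>t. t = \<xi> (fst z) \<longrightarrow>
       deriv (deriv h) t + 2 * deriv h t * deriv \<phi> t / \<phi> t = 0 \<and>
       scalar_curvature (metric M i) z = - deriv h t * deriv \<phi> t * \<phi> t * \<xi> N \<and>
       scalar_curvature (metric M i) z * f t = deriv h t * (\<phi> t)\<^sup>2 * deriv f t * \<xi> N)"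
proof -
  let ?u = "\<lambda>z :: 'b \<times> 'p. h (\<xi> (fst z))"
  have "smooth_function M ?u"
    unfolding smooth_function_def
  proof
    fix i assume "i \<in> charts M"
    then have i: "i \<in> charts F" by (simp add: warped_product_simps(2))
    have op: "open (\<Omega> \<times> chart_image F i)"
      using F i open_\<Omega> unfolding semi_riemannian_manifold_def smooth_manifold_def
      by (simp add: open_Times)
    have hk: "Ck_on k \<Omega> (\<lambda>x. h (\<xi> x))" for k
      using smooth_on_along_\<xi>[OF h] unfolding smooth_on_def by blast
    have "Ck_on k (\<Omega> \<times> chart_image F i) (\<lambda>z. h (\<xi> (fst z)))" for k
      by (rule Ck_on_compose_linear[OF bounded_linear_fst op _ hk]) auto
    then show "smooth_on (chart_image M i) (?u \<circ> param M i)"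
      unfolding smooth_on_def warped_product_chart_image
      using Ck_on_cong[OF op, of "?u \<circ> param M i" "\<lambda>z. h (\<xi> (fst z))"] potential_in_chart[OF i]
      by blast
  qed
  then have "steady_gradient_yamabe_soliton M ?u \<longleftrightarrow>
      (\<forall>i\<in>charts F. \<forall>z \<in> \<Omega> \<times> chart_image F i. \<forall>V W.
        scalar_curvature (metric M i) z * metric M i z V W =
          hessian (metric M i) (?u \<circ> param M i) z V W)"
    unfolding steady_gradient_yamabe_soliton_def gradient_yamabe_soliton_def
    using M_semi_riemannian by (simp add: warped_product_simps(2) warped_product_chart_image)
  also have "\<dots> \<longleftrightarrow> (\<forall>i\<in>charts F. \<forall>z \<in> \<Omega> \<times> chart_image F i. \<forall>t. t = \<xi> (fst z) \<longrightarrow>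
       deriv (deriv h) t + 2 * deriv h t * deriv \<phi> t / \<phi> t = 0 \<and>
       scalar_curvature (metric M i) z = - deriv h t * deriv \<phi> t * \<phi> t * \<xi> N \<and>
       scalar_curvature (metric M i) z * f t = deriv h t * (\<phi> t)\<^sup>2 * deriv f t * \<xi> N)"
  proof (intro ball_cong refl)
    fix i z assume i: "i \<in> charts F" and z: "z \<in> \<Omega> \<times> chart_image F i"
    define t where "t = \<xi> (fst z)"
    have tI: "t \<in> I" and y: "snd z \<in> chart_image F i" using z by (auto simp: t_def)
    have nz: "\<phi> t > 0" "f t > 0" using \<phi>_pos f_pos tI by auto
    let ?S = "scalar_curvature (metric M i) z"
    have "(\<forall>V W. ?S * metric M i z V W = hessian (metric M i) (?u \<circ> param M i) z V W) \<longleftrightarrow>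
      (\<forall>V W. ?S / (\<phi> t)\<^sup>2 * (B (fst V) (fst W) +
            (\<phi> t)\<^sup>2 * (f t)\<^sup>2 * metric F i (snd z) (snd V) (snd W)) =
          (deriv (deriv h) t + 2 * deriv h t * deriv \<phi> t / \<phi> t) * \<xi> (fst V) * \<xi> (fst W) +
          (- deriv h t * deriv \<phi> t / \<phi> t * \<xi> N) * B (fst V) (fst W) +
          (deriv h t * (\<phi> t)\<^sup>2 * f t * deriv f t * \<xi> N) * metric F i (snd z) (snd V) (snd W))"
      unfolding hessian_potential[OF i z t_def h] warped_product_metric t_def[symmetric]
      using nz by (simp add: distrib_left)
    also have "\<dots> \<longleftrightarrow> deriv (deriv h) t + 2 * deriv h t * deriv \<phi> t / \<phi> t = 0 \<and>
        ?S / (\<phi> t)\<^sup>2 = - deriv h t * deriv \<phi> t / \<phi> t * \<xi> N \<and>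
        ?S / (\<phi> t)\<^sup>2 * ((\<phi> t)\<^sup>2 * (f t)\<^sup>2) = deriv h t * (\<phi> t)\<^sup>2 * f t * deriv f t * \<xi> N"
      by (rule soliton_equation_coefficients[OF dim i y])
    also have "?S / (\<phi> t)\<^sup>2 = - deriv h t * deriv \<phi> t / \<phi> t * \<xi> N \<longleftrightarrow>
        ?S = - deriv h t * deriv \<phi> t * \<phi> t * \<xi> N"
      using nz by (auto simp: field_simps power2_eq_square)
    also have "?S / (\<phi> t)\<^sup>2 * ((\<phi> t)\<^sup>2 * (f t)\<^sup>2) = deriv h t * (\<phi> t)\<^sup>2 * f t * deriv f t * \<xi> N \<longleftrightarrow>
        f t * (?S * f t) = f t * (deriv h t * (\<phi> t)\<^sup>2 * deriv f t * \<xi> N)"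
      using nz by (simp add: power2_eq_square mult.commute mult.left_commute)
    also have "\<dots> \<longleftrightarrow> ?S * f t = deriv h t * (\<phi> t)\<^sup>2 * deriv f t * \<xi> N"
      using nz by simp
    finally show "(\<forall>V W. ?S * metric M i z V W = hessian (metric M i) (?u \<circ> param M i) z V W) \<longleftrightarrow>
        (\<forall>t. t = \<xi> (fst z) \<longrightarrow> deriv (deriv h) t + 2 * deriv h t * deriv \<phi> t / \<phi> t = 0 \<and>
          ?S = - deriv h t * deriv \<phi> t * \<phi> t * \<xi> N \<and>
          ?S * f t = deriv h t * (\<phi> t)\<^sup>2 * deriv f t * \<xi> N)"
      unfolding t_def[symmetric] simp_thms .
  qed
  finally show ?thesis .
qed

text \<open>
  When \<open>f = k / \<phi>\<close> the metric is \<open>\<phi>\<^sup>-\<^sup>2\<close> times the product of the flat metric with \<open>k\<^sup>2 g\<^sub>F\<close>, and the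
  conformal change is along the parallel covector \<open>\<xi>\<close>.
\<close>

lemma scalar_curvature_conformal_product:
  assumes fk: "\<And>t. t \<in> I \<Longrightarrow> f t = k / \<phi> t" and i: "i \<in> charts F"
    and z: "z \<in> \<Omega> \<times> chart_image F i" and t: "t = \<xi> (fst z)"
  shows "scalar_curvature (metric M i) z =
    (\<phi> t)\<^sup>2 / k\<^sup>2 * scalar_curvature (metric F i) (snd z) +
    \<xi> N * (real (DIM('b) + DIM('e)) - 1) *
      (2 * \<phi> t * deriv (deriv \<phi>) t - real (DIM('b) + DIM('e)) * (deriv \<phi> t)\<^sup>2)"
proof -
  have tI: "t \<in> I" using z t by auto
  have nz: "\<phi> t \<noteq> 0" using \<phi>_pos[OF tI] by simp
  have k: "k \<noteq> 0" using fk[OF tI] f_pos[OF tI] by auto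
  interpret flat_product \<Omega> B k F i
    by (rule flat_product.intro[OF F i open_\<Omega> B k])
  interpret parallel_covector "\<Omega> \<times> chart_image F i" P "\<lambda>z. \<xi> (fst z)" "(N, 0)"
  proof
    show "\<xi> (fst (v + w)) = \<xi> (fst v) + \<xi> (fst w)" "\<xi> (fst (c *\<^sub>R v)) = c *\<^sub>R \<xi> (fst v)"
      for v w :: "'b \<times> 'e" and c
      by (simp_all add: linear_add[OF linear_\<xi>] linear_scale[OF linear_\<xi>])
    fix x v w assume x: "x \<in> \<Omega> \<times> chart_image F i"
    then have y: "snd x \<in> chart_image F i" by auto
    show "P x (N, 0) v = \<xi> (fst v)" by (simp add: P_eq N F.metric_linear_simps[OF y])
    show "dird (\<lambda>y. P y v w) x (N, 0) = 0"
      using dird_P[OF x, of v w "(N, 0)"] F.dg_linear(2)[OF y, where c = 0 and u = 0] by simp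
  qed
  have d: "(\<phi> has_real_derivative deriv \<phi> (\<xi> (fst x))) (at (\<xi> (fst x)))"
    "\<phi> (\<xi> (fst x)) \<noteq> 0" if "x \<in> \<Omega> \<times> chart_image F i" for x
    using that smooth_on_has_deriv[OF smooth_\<phi>, of "\<xi> (fst x)"] \<phi>_pos[of "\<xi> (fst x)"] by auto
  have s': "((\<lambda>t. - deriv \<phi> t / \<phi> t) has_real_derivative
      (- deriv (deriv \<phi>) t * \<phi> t + (deriv \<phi> t)\<^sup>2) / (\<phi> t)\<^sup>2) (at (\<xi> (fst z)))"
    unfolding t[symmetric] using nz
    by (auto intro!: derivative_eq_intros smooth_on_has_deriv[OF smooth_\<phi> tI]
        smooth_on_has_deriv[OF smooth_on_deriv[OF I(1) smooth_\<phi>] tI] simp: power2_eq_square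
        simp del: minus_divide_left[symmetric])
  have "scalar_curvature (metric M i) z = scalar_curvature (conf \<phi>) z"
  proof (rule scalar_curvature_cong[OF P.open_dom z], intro ext)
    fix x V W assume x: "x \<in> \<Omega> \<times> chart_image F i"
    then have "f (\<xi> (fst x)) = k / \<phi> (\<xi> (fst x))" using fk by auto
    then show "metric M i x V W = conf \<phi> x V W"
      using d(2)[OF x]
      by (simp add: conf_def P_eq warped_product_metric power_divide add_divide_distrib)
  qed
  also have "\<dots> = (\<phi> t)\<^sup>2 * (scalar_curvature (metric F i) (snd z) / k\<^sup>2
    - \<xi> N * (real (DIM('b) + DIM('e)) - 1) *
      (2 * ((- deriv (deriv \<phi>) t * \<phi> t + (deriv \<phi> t)\<^sup>2) / (\<phi> t)\<^sup>2) +
       (real (DIM('b) + DIM('e)) - 2) * (- deriv \<phi> t / \<phi> t)\<^sup>2))"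
    using scalar_curvature_conf[OF d z s'] by (simp add: scalar_curvature_P[OF z] t)
  also have "\<dots> = (\<phi> t)\<^sup>2 / k\<^sup>2 * scalar_curvature (metric F i) (snd z) +
    \<xi> N * (real (DIM('b) + DIM('e)) - 1) *
      (2 * \<phi> t * deriv (deriv \<phi>) t - real (DIM('b) + DIM('e)) * (deriv \<phi> t)\<^sup>2)"
    using nz by (simp add: field_simps power2_eq_square)
  finally show ?thesis .
qed

text \<open>
  Eliminating the scalar curvature from the base and fibre equations gives \<open>(f \<phi>)' = 0\<close>. This makes
  the metric conformal to a scalar-flat product, so the scalar curvature is known and the base
  equation becomes an ordinary differential equation for \<open>\<phi>\<close>.
\<close>

lemma steady_iff_ode:
  assumes h: "smooth_on I h" and h': "\<And>t. t \<in> I \<Longrightarrow> deriv h t \<noteq> 0"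
    and dim: "DIM('b) \<ge> 2" and "convex I" and flat: "constant_scalar_curvature F 0"
  shows "steady_gradient_yamabe_soliton M (\<lambda>z. h (\<xi> (fst z))) \<longleftrightarrow>
    (\<forall>t\<in>I. deriv (deriv h) t * \<phi> t + 2 * deriv h t * deriv \<phi> t = 0) \<and>
    (\<forall>t\<in>I. deriv f t * \<phi> t + f t * deriv \<phi> t = 0) \<and>
    (\<forall>t\<in>I. (real (DIM('b) + DIM('e)) - 1) *
       (2 * \<phi> t * deriv (deriv \<phi>) t - real (DIM('b) + DIM('e)) * (deriv \<phi> t)\<^sup>2) =
       - deriv h t * deriv \<phi> t * \<phi> t)"
  (is "_ \<longleftrightarrow> (\<forall>t\<in>I. ?E1 t) \<and> (\<forall>t\<in>I. ?E2 t) \<and> (\<forall>t\<in>I. ?A t = ?C t)")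
proof -
  define Q where "Q i z t \<longleftrightarrow>
       deriv (deriv h) t + 2 * deriv h t * deriv \<phi> t / \<phi> t = 0 \<and>
       scalar_curvature (metric M i) z = - deriv h t * deriv \<phi> t * \<phi> t * \<xi> N \<and>
       scalar_curvature (metric M i) z * f t = deriv h t * (\<phi> t)\<^sup>2 * deriv f t * \<xi> N" for i z t
  have Q_iff: "Q i z t \<longleftrightarrow> ?E1 t \<and> ?E2 t \<and>
      scalar_curvature (metric M i) z = - deriv h t * deriv \<phi> t * \<phi> t * \<xi> N" if "t \<in> I" for i z t
  proof -
    have nz: "\<phi> t > 0" "deriv h t \<noteq> 0" using \<phi>_pos h' that by auto
    have "deriv (deriv h) t + 2 * deriv h t * deriv \<phi> t / \<phi> t = 0 \<longleftrightarrow> ?E1 t"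
      using nz by (simp add: field_simps)
    moreover have "- deriv h t * deriv \<phi> t * \<phi> t * \<xi> N * f t = deriv h t * (\<phi> t)\<^sup>2 * deriv f t * \<xi> N
        \<longleftrightarrow> ?E2 t"
    proof -
      have "- deriv h t * deriv \<phi> t * \<phi> t * \<xi> N * f t - deriv h t * (\<phi> t)\<^sup>2 * deriv f t * \<xi> N =
          - (deriv h t * \<phi> t * \<xi> N) * (deriv f t * \<phi> t + f t * deriv \<phi> t)"
        by (simp add: algebra_simps power2_eq_square)
      then show ?thesis using nz \<xi>_N
        by (metis eq_iff_diff_eq_0 mult_eq_0_iff neg_equal_0_iff_equal order_less_irrefl)
    qed
    ultimately show ?thesis unfolding Q_def by metis
  qed
  have scal: "scalar_curvature (metric M i) z = \<xi> N * ?A (\<xi> (fst z))"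
    if E2: "\<forall>t\<in>I. ?E2 t" and i: "i \<in> charts F" and z: "z \<in> \<Omega> \<times> chart_image F i" for i z
  proof -
    have "((\<lambda>t. f t * \<phi> t) has_real_derivative 0) (at t)" if "t \<in> I" for t
      using DERIV_mult[OF smooth_on_has_deriv[OF smooth_f that] smooth_on_has_deriv[OF smooth_\<phi> that]]
        E2 that by (simp add: mult.commute)
    then obtain k where k: "\<And>t. t \<in> I \<Longrightarrow> f t * \<phi> t = k"
      using deriv_0_imp_const[OF \<open>convex I\<close>] by blast
    have "f t = k / \<phi> t" if "t \<in> I" for t
      using k[OF that] \<phi>_pos[OF that] by (simp add: field_simps)
    moreover have "scalar_curvature (metric F i) (snd z) = 0"
      using flat i z unfolding constant_scalar_curvature_def by auto
    ultimately show ?thesis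
      using scalar_curvature_conformal_product[OF _ i z refl, of k] by simp
  qed
  have "smooth_manifold F" using F unfolding semi_riemannian_manifold_def by blast
  then obtain i0 p0 where i0: "i0 \<in> charts F" "p0 \<in> cdom F i0"
    unfolding smooth_manifold_def by blast
  have point: "\<exists>z. z \<in> \<Omega> \<times> chart_image F i0 \<and> \<xi> (fst z) = t" if "t \<in> I" for t
  proof -
    obtain x where "\<xi> x = t" by (rule \<xi>_surj)
    then show ?thesis using that i0
      by (intro exI[of _ "(x, coord F i0 p0)"]) (auto simp: chart_image_def)
  qed
  have "steady_gradient_yamabe_soliton M (\<lambda>z. h (\<xi> (fst z))) \<longleftrightarrow>
      (\<forall>i\<in>charts F. \<forall>z \<in> \<Omega> \<times> chart_image F i. Q i z (\<xi> (fst z)))"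
    unfolding steady_iff_scalar_curvature[OF h dim] Q_def by simp
  also have "\<dots> \<longleftrightarrow> (\<forall>t\<in>I. ?E1 t) \<and> (\<forall>t\<in>I. ?E2 t) \<and> (\<forall>t\<in>I. ?A t = ?C t)" (is "?L \<longleftrightarrow> ?R")
  proof
    assume L: ?L
    have *: "\<exists>z \<in> \<Omega> \<times> chart_image F i0. \<xi> (fst z) = t \<and> Q i0 z t" if "t \<in> I" for t
      using point[OF that] L i0 by blast
    then have E: "?E1 t" "?E2 t" if "t \<in> I" for t
      using that Q_iff[OF that] by blast+
    have "?A t = ?C t" if "t \<in> I" for t
    proof -
      obtain z where z: "z \<in> \<Omega> \<times> chart_image F i0" "\<xi> (fst z) = t" "Q i0 z t"
        using *[OF \<open>t \<in> I\<close>] by blast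
      have "\<xi> N * ?A t = ?C t * \<xi> N"
        using scal[OF _ i0(1) z(1)] E(2) z(2,3) Q_iff[OF that] by simp
      then show ?thesis using \<xi>_N by (simp only: mult.commute[of "\<xi> N"] mult_cancel_right) simp
    qed
    then show ?R using E by simp
  next
    assume R: ?R
    show ?L
    proof (intro ballI)
      fix i z assume i: "i \<in> charts F" and z: "z \<in> \<Omega> \<times> chart_image F i"
      then have t: "\<xi> (fst z) \<in> I" by auto
      show "Q i z (\<xi> (fst z))"
        unfolding Q_iff[OF t] scal[OF conjunct1[OF conjunct2[OF R]] i z]
        using R t by (simp del: of_nat_add add: mult.commute[of "\<xi> N"])
    qed
  qed
  finally show ?thesis .
qed

end

section \<open>Solving the soliton equations\<close>

lemma convex_einterval: "convex (einterval a b)"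
proof -
  have "is_interval (einterval a b)"
    unfolding is_interval_1
  proof (intro ballI allI impI)
    fix x y z assume x: "x \<in> einterval a b" and y: "y \<in> einterval a b" and z: "x \<le> z \<and> z \<le> y"
    have "a < ereal x" "ereal x \<le> ereal z" "ereal z \<le> ereal y" "ereal y < b"
      using x y z by (simp_all add: einterval_iff)
    then show "z \<in> einterval a b"
      unfolding einterval_iff using less_le_trans le_less_trans by blast
  qed
  then show ?thesis by (rule is_interval_convex)
qed

text \<open>
  Multiplying by the integrating factor \<open>exp (- \<integral> c)\<close> turns a solution of \<open>D' = c D\<close> into a constant.
\<close>

lemma linear_ode_vanishing:
  fixes D c :: "real \<Rightarrow> real"
  assumes ab: "(a::ereal) < b" and c: "continuous_on (einterval a b) c"
    and D: "\<And>t. t \<in> einterval a b \<Longrightarrow> (D has_real_derivative c t * D t) (at t)"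
    and t0: "t0 \<in> einterval a b" "D t0 = 0" and t: "t \<in> einterval a b"
  shows "D t = 0"
proof -
  have "isCont c t" if "a < ereal t" "ereal t < b" for t
  proof -
    have "t \<in> einterval a b" using that by (simp add: einterval_iff)
    then show ?thesis using c continuous_on_eq_continuous_at[OF open_einterval] by blast
  qed
  then obtain C where C: "\<And>t. t \<in> einterval a b \<Longrightarrow> (C has_real_derivative c t) (at t)"
    using einterval_antiderivative[OF ab]
    unfolding has_real_derivative_iff_has_vector_derivative einterval_iff by metis
  have "((\<lambda>t. D t * exp (- C t)) has_real_derivative 0) (at t)" if "t \<in> einterval a b" for t
    by (rule derivative_eq_intros D C that refl | simp add: that)+
  then obtain k where "\<And>t. t \<in> einterval a b \<Longrightarrow> D t * exp (- C t) = k"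
    using deriv_0_imp_const[of "einterval a b"] convex_einterval by blast
  then have "D t * exp (- C t) = D t0 * exp (- C t0)" using t0 t by metis
  then show ?thesis using t0 by simp
qed

lemma inj_on_of_deriv_nonzero:
  fixes F :: "real \<Rightarrow> real"
  assumes "convex I" and F: "\<And>t. t \<in> I \<Longrightarrow> (F has_real_derivative F' t) (at t)"
    and nz: "\<And>t. t \<in> I \<Longrightarrow> F' t \<noteq> 0"
  shows "inj_on F I"
proof (rule linorder_inj_onI)
  fix x y assume xy: "x < y" "x \<in> I" "y \<in> I"
  then have sub: "t \<in> I" if "x \<le> t" "t \<le> y" for t
    using \<open>convex I\<close> that unfolding is_interval_convex_1[symmetric] is_interval_1 by blast
  obtain z where "x < z" "z < y" "F y - F x = (y - x) * F' z"
    using MVT2[OF xy(1), of F F'] F sub by blast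
  then show "F x \<noteq> F y" using nz[of z] sub[of z] xy by auto
qed auto

lemma antiderivative_form_iff:
  assumes "open I"
    and h: "\<And>t. t \<in> I \<Longrightarrow> (h has_real_derivative h' t) (at t)"
    and "k \<noteq> 0"
  shows "(\<exists>H. antiderivative_on I w H \<and> (\<forall>t\<in>I. h t = k * H t)) \<longleftrightarrow> (\<forall>t\<in>I. h' t = k * w t)"
proof
  assume "\<exists>H. antiderivative_on I w H \<and> (\<forall>t\<in>I. h t = k * H t)"
  then obtain H where H: "\<And>t. t \<in> I \<Longrightarrow> (H has_real_derivative w t) (at t)"
      "\<And>t. t \<in> I \<Longrightarrow> h t = k * H t"
    unfolding antiderivative_on_def by blast
  show "\<forall>t\<in>I. h' t = k * w t"
  proof
    fix t assume t: "t \<in> I"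
    have "(h has_real_derivative k * w t) (at t)"
      by (rule has_field_derivative_transform_within_open[OF DERIV_cmult[OF H(1)[OF t]] \<open>open I\<close> t])
        (simp add: H(2))
    then show "h' t = k * w t" using h[OF t] DERIV_unique by blast
  qed
next
  assume "\<forall>t\<in>I. h' t = k * w t"
  then have "((\<lambda>t. h t / k) has_real_derivative w t) (at t)" if "t \<in> I" for t
    using DERIV_cdivide[OF h[OF that], of k] that \<open>k \<noteq> 0\<close> by simp
  then show "\<exists>H. antiderivative_on I w H \<and> (\<forall>t\<in>I. h t = k * H t)"
    using \<open>k \<noteq> 0\<close> unfolding antiderivative_on_def by (intro exI[of _ "\<lambda>t. h t / k"]) simp
qed

text \<open>
  The right-hand side is \<open>40 \<phi> \<phi>' = D\<close> with \<open>D = k1 - 20 k3 \<phi>\<^sup>4\<close>; the left-hand side is its form after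
  separation of variables, which requires \<open>D \<noteq> 0\<close>. Along a solution \<open>D' = - 2 k3 \<phi>\<^sup>2 D\<close>, so \<open>D\<close> either
  vanishes nowhere or vanishes identically, and in the latter case \<open>\<phi>\<close> is constant because
  \<open>k1 \<noteq> 0\<close>.
\<close>

lemma implicit_integral_iff:
  fixes k1 k3 :: real
  assumes ab: "a < b"
    and \<phi>: "\<And>t. t \<in> einterval a b \<Longrightarrow> (\<phi> has_real_derivative \<phi>' t) (at t)"
    and pos: "\<And>t. t \<in> einterval a b \<Longrightarrow> \<phi> t > 0" and "k1 \<noteq> 0"
  shows "(\<exists>k4. ((\<forall>t \<in> einterval a b. k1 - 20 * k3 * \<phi> t ^ 4 \<noteq> 0) \<and>
             (\<exists>G. antiderivative_on (\<phi> ` einterval a b) (\<lambda>s. s / (k1 - 20 * k3 * s ^ 4)) G \<and>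
                  (\<forall>t \<in> einterval a b. 40 * G (\<phi> t) = t + k4))
             \<or> (\<forall>t \<in> einterval a b. k1 - 20 * k3 * \<phi> t ^ 4 = 0)))
         \<longleftrightarrow> (\<forall>t \<in> einterval a b. 40 * \<phi> t * \<phi>' t = k1 - 20 * k3 * \<phi> t ^ 4)"
  (is "?L \<longleftrightarrow> ?R")
proof
  let ?I = "einterval a b"
  let ?D = "\<lambda>t. k1 - 20 * k3 * \<phi> t ^ 4"
  assume ?L
  then consider (moving_case) k4 G where "\<And>t. t \<in> ?I \<Longrightarrow> ?D t \<noteq> 0"
      "antiderivative_on (\<phi> ` ?I) (\<lambda>s. s / (k1 - 20 * k3 * s ^ 4)) G"
      "\<And>t. t \<in> ?I \<Longrightarrow> 40 * G (\<phi> t) = t + k4"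
    | (constant_case) "\<And>t. t \<in> ?I \<Longrightarrow> ?D t = 0" by blast
  then show ?R
  proof cases
    case moving_case
    show ?thesis
    proof
      fix t assume t: "t \<in> ?I"
      have "(G has_real_derivative \<phi> t / ?D t) (at (\<phi> t))"
        using moving_case(2) t unfolding antiderivative_on_def by auto
      from DERIV_chain2[OF this \<phi>[OF t]]
      have "((\<lambda>t. 40 * G (\<phi> t) - t) has_real_derivative 40 * (\<phi> t / ?D t * \<phi>' t) - 1) (at t)"
        by (intro DERIV_diff DERIV_cmult DERIV_ident)
      then have "40 * (\<phi> t / ?D t * \<phi>' t) - 1 = 0"
        by (rule const_imp_deriv_0[OF _ open_einterval t, of _ _ k4]) (simp add: moving_case(3))
      moreover have "40 * x * y = d" if "40 * (x / d * y) - 1 = 0" "d \<noteq> 0" for x y d :: real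
        using that by (simp add: field_simps)
      ultimately show "40 * \<phi> t * \<phi>' t = ?D t" using moving_case(1)[OF t] by blast
    qed
  next
    case constant_case
    show ?thesis
    proof
      fix t assume t: "t \<in> ?I"
      have "k3 \<noteq> 0" using constant_case[OF t] \<open>k1 \<noteq> 0\<close> by auto
      have "(?D has_real_derivative - (20 * k3 * (4 * \<phi> t ^ 3 * \<phi>' t))) (at t)"
        by (auto intro!: derivative_eq_intros \<phi>[OF t])
      from const_imp_deriv_0[OF this open_einterval t, of 0]
      have "k3 * \<phi> t ^ 3 * \<phi>' t = 0" using constant_case by simp
      then have "\<phi>' t = 0" using \<open>k3 \<noteq> 0\<close> pos[OF t] by simp
      then show "40 * \<phi> t * \<phi>' t = ?D t" using constant_case[OF t] by simp
    qed
  qed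
next
  let ?I = "einterval a b"
  let ?D = "\<lambda>t. k1 - 20 * k3 * \<phi> t ^ 4"
  assume R: ?R
  have D': "(?D has_real_derivative (- 2 * k3 * (\<phi> t)\<^sup>2) * ?D t) (at t)" if t: "t \<in> ?I" for t
  proof -
    have "(?D has_real_derivative - (20 * k3 * (4 * \<phi> t ^ 3 * \<phi>' t))) (at t)"
      by (auto intro!: derivative_eq_intros \<phi>[OF t])
    moreover have "- (20 * k3 * (4 * \<phi> t ^ 3 * \<phi>' t)) = (- 2 * k3 * (\<phi> t)\<^sup>2) * (40 * \<phi> t * \<phi>' t)"
      by (simp add: power2_eq_square power3_eq_cube)
    ultimately show ?thesis by (simp only: R[rule_format, OF t])
  qed
  have cont: "continuous_on ?I (\<lambda>t. - 2 * k3 * (\<phi> t)\<^sup>2)"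
    using \<phi> by (intro continuous_intros DERIV_continuous_on) (auto intro: has_field_derivative_at_within)
  show ?L
  proof (cases "\<exists>t0\<in>?I. ?D t0 = 0")
    case True
    then have "\<forall>t\<in>?I. ?D t = 0" using linear_ode_vanishing[OF ab cont D'] by blast
    then show ?thesis by blast
  next
    case False
    have \<phi>'_nz: "\<phi>' t \<noteq> 0" if "t \<in> ?I" for t using R False that by force
    have inj: "inj_on \<phi> ?I"
      using inj_on_of_deriv_nonzero[OF _ \<phi> \<phi>'_nz] convex_einterval by blast
    \<comment> \<open>The implicit relation says that \<open>40 G\<close> inverts \<open>\<phi>\<close>, up to the constant \<open>k4\<close>.\<close>
    define G where "G s = inv_into ?I \<phi> s / 40" for s
    have "(G has_real_derivative s / (k1 - 20 * k3 * s ^ 4)) (at s)" if "s \<in> \<phi> ` ?I" for s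
    proof -
      obtain t where t: "t \<in> ?I" "s = \<phi> t" using \<open>s \<in> \<phi> ` ?I\<close> by blast
      have "continuous_on ?I \<phi>"
        using \<phi> by (intro DERIV_continuous_on) (auto intro: has_field_derivative_at_within)
      then have "(inv_into ?I \<phi> has_real_derivative inverse (\<phi>' t)) (at (\<phi> t))"
        unfolding has_field_derivative_def
        by (rule has_derivative_inverse_strong[OF open_einterval t(1) _ _
              \<phi>[OF t(1), unfolded has_field_derivative_def]])
          (use inj \<phi>'_nz[OF t(1)] in \<open>auto simp: inv_into_f_f\<close>)
      from DERIV_cdivide[OF this, of 40]
      have "(G has_real_derivative inverse (\<phi>' t) / 40) (at (\<phi> t))" by (simp add: G_def[abs_def])
      moreover have "inverse (\<phi>' t) / 40 = \<phi> t / ?D t"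
        unfolding R[rule_format, OF t(1), symmetric] using pos[OF t(1)] \<phi>'_nz[OF t(1)]
        by (simp add: field_simps)
      ultimately show ?thesis using t by simp
    qed
    moreover have "40 * G (\<phi> t) = t + 0" if "t \<in> ?I" for t
      using inj that by (simp add: G_def inv_into_f_f)
    ultimately have "antiderivative_on (\<phi> ` ?I) (\<lambda>s. s / (k1 - 20 * k3 * s ^ 4)) G \<and>
        (\<forall>t\<in>?I. 40 * G (\<phi> t) = t + 0)"
      unfolding antiderivative_on_def by blast
    then show ?thesis using False by blast
  qed
qed

text \<open>
  Each of the three equations has a first integral: \<open>k1 = h' \<phi>\<^sup>2\<close>, \<open>k2 = f \<phi>\<close>, and, after substituting
  \<open>h' = k1 / \<phi>\<^sup>2\<close> into the third one, \<open>k3 = (k1 - 40 \<phi> \<phi>') / (20 \<phi>\<^sup>4)\<close>.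
\<close>

lemma soliton_ode_iff:
  fixes \<phi> f h :: "real \<Rightarrow> real"
  assumes I: "open I" "convex I" "x0 \<in> I"
    and smooth: "smooth_on I \<phi>" "smooth_on I f" "smooth_on I h"
    and pos: "\<And>t. t \<in> I \<Longrightarrow> \<phi> t > 0" "\<And>t. t \<in> I \<Longrightarrow> f t > 0"
    and h': "\<And>t. t \<in> I \<Longrightarrow> deriv h t \<noteq> 0"
  shows "(\<forall>t\<in>I. deriv (deriv h) t * \<phi> t + 2 * deriv h t * deriv \<phi> t = 0) \<and>
    (\<forall>t\<in>I. deriv f t * \<phi> t + f t * deriv \<phi> t = 0) \<and>
    (\<forall>t\<in>I. 10 * \<phi> t * deriv (deriv \<phi>) t - 30 * (deriv \<phi> t)\<^sup>2 = - deriv h t * deriv \<phi> t * \<phi> t)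
    \<longleftrightarrow> (\<exists>k1 k2 k3. k1 \<noteq> 0 \<and> k2 \<noteq> 0 \<and> (\<forall>t\<in>I. f t = k2 / \<phi> t) \<and>
      (\<forall>t\<in>I. deriv h t = k1 * (1 / (\<phi> t)\<^sup>2)) \<and>
      (\<forall>t\<in>I. 40 * \<phi> t * deriv \<phi> t = k1 - 20 * k3 * \<phi> t ^ 4))"
  (is "(\<forall>t\<in>I. ?E1 t) \<and> (\<forall>t\<in>I. ?E2 t) \<and> (\<forall>t\<in>I. ?E3 t) \<longleftrightarrow> ?R")
proof -
  note d = smooth_on_has_deriv[OF smooth(1)] smooth_on_has_deriv[OF smooth(2)]
    smooth_on_has_deriv[OF smooth(3)]
    smooth_on_has_deriv[OF smooth_on_deriv[OF I(1) smooth(1)]]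
    smooth_on_has_deriv[OF smooth_on_deriv[OF I(1) smooth(3)]]
  have d1: "((\<lambda>t. deriv h t * (\<phi> t)\<^sup>2) has_real_derivative
      \<phi> t * (deriv (deriv h) t * \<phi> t + 2 * deriv h t * deriv \<phi> t)) (at t)" if "t \<in> I" for t
    by (auto intro!: derivative_eq_intros d that simp: algebra_simps power2_eq_square)
  have d2: "((\<lambda>t. f t * \<phi> t) has_real_derivative deriv f t * \<phi> t + f t * deriv \<phi> t) (at t)"
    if "t \<in> I" for t
    by (auto intro!: derivative_eq_intros d that)
  show ?thesis
  proof
    assume "(\<forall>t\<in>I. ?E1 t) \<and> (\<forall>t\<in>I. ?E2 t) \<and> (\<forall>t\<in>I. ?E3 t)"
    then have E: "?E1 t" "?E2 t" "?E3 t" if "t \<in> I" for t using that by blast+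
    obtain k1 where k1: "\<And>t. t \<in> I \<Longrightarrow> deriv h t * (\<phi> t)\<^sup>2 = k1"
      using deriv_0_imp_const[OF I(2), of "\<lambda>t. deriv h t * (\<phi> t)\<^sup>2"] d1 E(1) by force
    obtain k2 where k2: "\<And>t. t \<in> I \<Longrightarrow> f t * \<phi> t = k2"
      using deriv_0_imp_const[OF I(2), of "\<lambda>t. f t * \<phi> t"] d2 E(2) by force
    have "((\<lambda>t. (k1 - 40 * \<phi> t * deriv \<phi> t) / (20 * \<phi> t ^ 4)) has_real_derivative 0) (at t)"
      if t: "t \<in> I" for t
    proof -
      have nz: "\<phi> t \<noteq> 0" using pos[OF t] by simp
      have "k1 * deriv \<phi> t = - \<phi> t * (10 * \<phi> t * deriv (deriv \<phi>) t - 30 * (deriv \<phi> t)\<^sup>2)"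
        unfolding E(3)[OF t] k1[OF t, symmetric] by (simp add: power2_eq_square)
      then have "k1 * deriv \<phi> t * \<phi> t ^ 3 =
          - \<phi> t * (10 * \<phi> t * deriv (deriv \<phi>) t - 30 * (deriv \<phi> t)\<^sup>2) * \<phi> t ^ 3" by simp
      then have "- (40 * (deriv \<phi> t * deriv \<phi> t + \<phi> t * deriv (deriv \<phi>) t)) * (20 * \<phi> t ^ 4)
          - (k1 - 40 * \<phi> t * deriv \<phi> t) * (20 * (4 * \<phi> t ^ 3 * deriv \<phi> t)) = 0"
        by (simp add: power2_eq_square power3_eq_cube power4_eq_xxxx algebra_simps)
      moreover have "((\<lambda>t. (k1 - 40 * \<phi> t * deriv \<phi> t) / (20 * \<phi> t ^ 4)) has_real_derivative
          (- (40 * (deriv \<phi> t * deriv \<phi> t + \<phi> t * deriv (deriv \<phi>) t)) * (20 * \<phi> t ^ 4)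
          - (k1 - 40 * \<phi> t * deriv \<phi> t) * (20 * (4 * \<phi> t ^ 3 * deriv \<phi> t))) /
          ((20 * \<phi> t ^ 4) * (20 * \<phi> t ^ 4))) (at t)"
        using nz by (auto intro!: derivative_eq_intros d t simp: algebra_simps)
      ultimately show ?thesis by (simp only: div_0)
    qed
    then obtain k3 where k3: "\<And>t. t \<in> I \<Longrightarrow> (k1 - 40 * \<phi> t * deriv \<phi> t) / (20 * \<phi> t ^ 4) = k3"
      using deriv_0_imp_const[OF I(2)] by blast
    have "k1 \<noteq> 0" using k1[OF I(3)] h'[OF I(3)] pos(1)[OF I(3)] by auto
    moreover have "k2 \<noteq> 0" using k2[OF I(3)] pos[OF I(3)] by auto
    moreover have "f t = k2 / \<phi> t" "deriv h t = k1 * (1 / (\<phi> t)\<^sup>2)"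
      "40 * \<phi> t * deriv \<phi> t = k1 - 20 * k3 * \<phi> t ^ 4" if "t \<in> I" for t
      using k1[OF that] k2[OF that] k3[OF that] pos(1)[OF that] by (auto simp: field_simps)
    ultimately show ?R by blast
  next
    assume ?R
    then obtain k1 k2 k3 where k: "\<And>t. t \<in> I \<Longrightarrow> f t = k2 / \<phi> t"
      "\<And>t. t \<in> I \<Longrightarrow> deriv h t = k1 * (1 / (\<phi> t)\<^sup>2)"
      "\<And>t. t \<in> I \<Longrightarrow> 40 * \<phi> t * deriv \<phi> t = k1 - 20 * k3 * \<phi> t ^ 4" by blast
    have nz: "\<phi> t \<noteq> 0" if "t \<in> I" for t using pos(1)[OF that] by simp
    have "?E1 t" if t: "t \<in> I" for t
      using const_imp_deriv_0[OF d1[OF t] I(1) t, of k1] k(2) nz by (simp add: t)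
    moreover have "?E2 t" if t: "t \<in> I" for t
      using const_imp_deriv_0[OF d2[OF t] I(1) t, of k2] k(1) nz by simp
    moreover have "?E3 t" if t: "t \<in> I" for t
    proof -
      have "((\<lambda>t. 40 * \<phi> t * deriv \<phi> t - (k1 - 20 * k3 * \<phi> t ^ 4)) has_real_derivative
          40 * (deriv \<phi> t * deriv \<phi> t + \<phi> t * deriv (deriv \<phi>) t) + 20 * k3 * (4 * \<phi> t ^ 3 * deriv \<phi> t)) (at t)"
        by (auto intro!: derivative_eq_intros d t simp: algebra_simps)
      from const_imp_deriv_0[OF this I(1) t, of 0]
      have 1: "40 * (deriv \<phi> t * deriv \<phi> t + \<phi> t * deriv (deriv \<phi>) t) + 20 * k3 * (4 * \<phi> t ^ 3 * deriv \<phi> t) = 0"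
        using k(3) by simp
      have "deriv h t * (\<phi> t)\<^sup>2 = k1" using k(2)[OF t] nz[OF t] by simp
      then have 2: "deriv h t * (\<phi> t)\<^sup>2 = 40 * \<phi> t * deriv \<phi> t + 20 * k3 * \<phi> t ^ 4"
        using k(3)[OF t] by simp
      \<comment> \<open>A combination of the integrated equation, weighted by \<open>4 \<phi>'\<close>, and its derivative, weighted by \<open>\<phi>\<close>.\<close>
      have "4 * \<phi> t * (10 * \<phi> t * deriv (deriv \<phi>) t - 30 * (deriv \<phi> t)\<^sup>2 + deriv h t * deriv \<phi> t * \<phi> t) =
         \<phi> t * (40 * (deriv \<phi> t * deriv \<phi> t + \<phi> t * deriv (deriv \<phi>) t) + 20 * k3 * (4 * \<phi> t ^ 3 * deriv \<phi> t))
         + 4 * deriv \<phi> t * (deriv h t * (\<phi> t)\<^sup>2 - (40 * \<phi> t * deriv \<phi> t + 20 * k3 * \<phi> t ^ 4))"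
        by (simp add: power2_eq_square power3_eq_cube power4_eq_xxxx algebra_simps)
      also have "\<dots> = 0" unfolding 1 2 by simp
      finally show ?thesis using nz[OF t] by simp
    qed
    ultimately show "(\<forall>t\<in>I. ?E1 t) \<and> (\<forall>t\<in>I. ?E2 t) \<and> (\<forall>t\<in>I. ?E3 t)" by blast
  qed
qed

section \<open>The classification in dimension six\<close>

lemma bilinear_flat_metric: "bilinear (flat_metric \<epsilon>)"
  unfolding bilinear_def linear_iff flat_metric_def
  by (simp add: algebra_simps sum.distrib sum_distrib_left)

lemma flat_metric_axis: "flat_metric \<epsilon> v (axis i 1) = \<epsilon> i * v $ i"
proof -
  have "flat_metric \<epsilon> v (axis i 1) = (\<Sum>j\<in>UNIV. if j = i then \<epsilon> i * v $ i else 0)"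
    unfolding flat_metric_def by (rule sum.cong) (auto simp: axis_def)
  then show ?thesis by simp
qed

theorem theorem1p10:
  fixes \<epsilon> :: "'n::finite \<Rightarrow> real"
    and \<alpha> :: "real^'n"
    and F :: "('p, 'i, real^'d::finite) semi_riemannian"
    and a b :: ereal
    and \<phi> f h :: "real \<Rightarrow> real"
    and \<xi> :: "real^'n \<Rightarrow> real"
  assumes "CARD('n) \<ge> 3" and "CARD('d) \<ge> 1" and "CARD('n) + CARD('d) = 6"
    and "\<And>i. \<epsilon> i = 1 \<or> \<epsilon> i = -1"
    and "semi_riemannian_manifold F" and "constant_scalar_curvature F 0"
    and "\<alpha> \<noteq> 0" and "flat_metric \<epsilon> \<alpha> \<alpha> \<noteq> 0"
    and "\<And>x. \<xi> x = (\<Sum>i\<in>UNIV. \<alpha> $ i * x $ i)"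
    and "a < b"
    and "smooth_on (einterval a b) \<phi>" and "smooth_on (einterval a b) f"
    and "smooth_on (einterval a b) h"
    and "\<And>t. t \<in> einterval a b \<Longrightarrow> \<phi> t > 0" and "\<And>t. t \<in> einterval a b \<Longrightarrow> f t > 0"
    and "\<And>t. t \<in> einterval a b \<Longrightarrow> h t > 0"
    and "\<And>t. t \<in> einterval a b \<Longrightarrow> deriv h t \<noteq> 0"
  shows "steady_gradient_yamabe_soliton
           (warped_product (\<xi> -` einterval a b)
              (\<lambda>x v w. flat_metric \<epsilon> v w / (\<phi> (\<xi> x))\<^sup>2) (\<lambda>x. f (\<xi> x)) F)
           (\<lambda>z. h (\<xi> (fst z)))
         \<longleftrightarrow>
         (\<exists>k1 k2 k3 k4 :: real. k1 \<noteq> 0 \<and> k2 \<noteq> 0 \<and>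
            (\<forall>t \<in> einterval a b. f t = k2 / \<phi> t) \<and>
            (\<exists>H. antiderivative_on (einterval a b) (\<lambda>t. 1 / (\<phi> t)\<^sup>2) H \<and>
                 (\<forall>t \<in> einterval a b. h t = k1 * H t)) \<and>
            ((\<forall>t \<in> einterval a b. k1 - 20 * k3 * \<phi> t ^ 4 \<noteq> 0) \<and>
             (\<exists>G. antiderivative_on (\<phi> ` einterval a b) (\<lambda>s. s / (k1 - 20 * k3 * s ^ 4)) G \<and>
                  (\<forall>t \<in> einterval a b. 40 * G (\<phi> t) = t + k4))
             \<or> (\<forall>t \<in> einterval a b. k1 - 20 * k3 * \<phi> t ^ 4 = 0)))"
proof -
  note smooth = assms(11-13) and pos = assms(14,15) and h' = assms(17) and \<xi> = assms(9)
  let ?I = "einterval a b"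
  define N where "N = (\<chi> i. \<epsilon> i * \<alpha> $ i)"
  have \<epsilon>2: "\<epsilon> i * \<epsilon> i = 1" and \<epsilon>0: "\<epsilon> i \<noteq> 0" for i using assms(4)[of i] by auto
  obtain x0 where x0: "x0 \<in> ?I"
    using ereal_dense2[OF \<open>a < b\<close>] by (auto simp: einterval_iff)
  have convex: "convex ?I" using convex_einterval .
  interpret conformally_flat_warped_product F "flat_metric \<epsilon>" \<xi> N ?I \<phi> f
  proof (rule conformally_flat_warped_product.intro)
    show "linear \<xi>"
      by (rule linearI) (simp_all add: \<xi> algebra_simps sum.distrib sum_distrib_left)
    show "flat_metric \<epsilon> v w = flat_metric \<epsilon> w v" for v w
      by (simp add: flat_metric_def mult.commute mult.left_commute)
    show "v = 0" if "\<forall>w. flat_metric \<epsilon> v w = 0" for v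
      using that flat_metric_axis[of \<epsilon> v] \<epsilon>0 by (simp add: vec_eq_iff)
    have e: "\<epsilon> i * (\<epsilon> i * r) = r" for i r using \<epsilon>2[of i] by (simp flip: mult.assoc)
    show "flat_metric \<epsilon> N v = \<xi> v" for v
      by (simp add: flat_metric_def N_def \<xi> mult.assoc e)
    have "\<xi> N = flat_metric \<epsilon> \<alpha> \<alpha>"
      by (simp add: flat_metric_def N_def \<xi> mult_ac)
    then show "\<xi> N \<noteq> 0" using assms(8) by simp
    show "?I \<noteq> {}" using x0 by blast
  qed (fact assms bilinear_flat_metric open_einterval)+
  have dim: "real (DIM(real^'n) + DIM(real^'d)) = 6"
    using assms(3) by simp
  have "steady_gradient_yamabe_soliton M (\<lambda>z. h (\<xi> (fst z))) \<longleftrightarrow>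
      (\<exists>k1 k2 k3. k1 \<noteq> 0 \<and> k2 \<noteq> 0 \<and> (\<forall>t\<in>?I. f t = k2 / \<phi> t) \<and>
      (\<forall>t\<in>?I. deriv h t = k1 * (1 / (\<phi> t)\<^sup>2)) \<and>
      (\<forall>t\<in>?I. 40 * \<phi> t * deriv \<phi> t = k1 - 20 * k3 * \<phi> t ^ 4))"
  proof -
    have "DIM(real^'n) \<ge> 2" using assms(1) by simp
    from steady_iff_ode[OF smooth(3) h' this convex assms(6)]
      soliton_ode_iff[OF open_einterval convex x0 smooth pos h']
    show ?thesis unfolding dim by (simp add: algebra_simps)
  qed
  also have "\<dots> \<longleftrightarrow> (\<exists>k1 k2 k3 k4. k1 \<noteq> 0 \<and> k2 \<noteq> 0 \<and> (\<forall>t \<in> ?I. f t = k2 / \<phi> t) \<and>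
            (\<exists>H. antiderivative_on ?I (\<lambda>t. 1 / (\<phi> t)\<^sup>2) H \<and> (\<forall>t \<in> ?I. h t = k1 * H t)) \<and>
            ((\<forall>t \<in> ?I. k1 - 20 * k3 * \<phi> t ^ 4 \<noteq> 0) \<and>
             (\<exists>G. antiderivative_on (\<phi> ` ?I) (\<lambda>s. s / (k1 - 20 * k3 * s ^ 4)) G \<and>
                  (\<forall>t \<in> ?I. 40 * G (\<phi> t) = t + k4))
             \<or> (\<forall>t \<in> ?I. k1 - 20 * k3 * \<phi> t ^ 4 = 0)))"
    using antiderivative_form_iff[OF open_einterval smooth_on_has_deriv[OF smooth(3)]]
      implicit_integral_iff[OF \<open>a < b\<close> smooth_on_has_deriv[OF smooth(1)] pos(1)]
    by (intro ex_cong1) (simp cong: conj_cong)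
  finally show ?thesis .
qed

end
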